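(* Let $n\geq 3$. Each of the following hyperplanes $H$ in $\mathbb{R}^n$: (T1) $H: x_1+x_2+\cdots+x_j=1+2+\cdots+(j-1)+(j+1)=\binom{j+1}{2}+1$, for $1\le j\leq n-2$; (T2) $H: x_1+x_2+\cdots+x_j=n+(n-1)+\cdots+(n-(j-2))+(n-j)$, for $1\le j\leq n-2$ (the right-hand side is the sum of the $j$ elements of $\{n-j\}\cup\{n-j+2,\dots,n\}$); (T3) $H: x_i=r$, where $2\leq r\leq n-1$ and $i\in\{1,n\}$; gives rise to a split of the permutahedron $\Pi_n$ into Bruhat interval polytopes, and hence into LPFMs. That is, the polytopes $\Pi_n\cap H^{\geq}$ and $\Pi_n\cap H^{\leq}$ are the two maximal cells of a split of $\Pi_n$, each of them is a Bruhat interval polytope, and each of them is the flag matroid polytope of a lattice path flag matroid (LPFM).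
   Context: $[n]=\{1,\dots,n\}$; $\mathfrak{S}_n$ is the symmetric group. A permutation $z\in\mathfrak{S}_n$ with one-line notation $z_1z_2\cdots z_n$ (where $z_i=z(i)$) is identified with the point $(z_1,\dots,z_n)\in\mathbb{R}^n$. The permutahedron is $\Pi_n=\mathrm{conv}\{(z_1,\dots,z_n): z\in\mathfrak{S}_n\}$. $\leq$ denotes the (strong) Bruhat order on $\mathfrak{S}_n$. Bruhat interval polytope (BIP): for $u\leq v$ in Bruhat order, $P_{[u,v]}=\mathrm{conv}\{(z_1,\dots,z_n): u\leq z\leq v\}$. For a hyperplane $H:\sum a_ix_i=b$, put $H^{\geq}=\{p\in\mathbb{R}^n:\sum a_ip_i\geq b\}$ and $H^{\leq}=\{p\in\mathbb{R}^n:\sum a_ip_i\leq b\}$. A split of a polytope $P$ is a polytopal subdivision of $P$ without new vertices (all vertices of the cells are vertices of $P$) having exactly two maximal cells $F_1,F_2$; the intersection $F_1\cap F_2$ is a codimension 1 cell, contained in the split hyperplane $H$, and $F_1,F_2$ are $P\cap H^{\geq}$ and $P\cap H^{\leq}$. Lattice path matroids: for $k$-subsets $U=\{u_1<\dots<u_k\}$, $L=\{l_1<\dots<l_k\}$ of $[n]$, write $U\leq_G L$ if $u_i\leq l_i$ for all $i$ (Gale order). If $U\leq_G L$, the lattice path matroid (LPM) $M[U,L]$ is the matroid on $[n]$ whose bases are the $k$-subsets $B$ with $U\leq_G B\leq_G L$. Flags: for matroids $M,N$ on $[n]$, $M$ is a quotient of $N$, written $M\leq_q N$, if every flat of $M$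 is a flat of $N$ (equivalently, every circuit of $N$ is a union of circuits of $M$). A lattice path flag matroid (LPFM) on $[n]$ is a sequence $M_1\leq_q M_2\leq_q\cdots\leq_q M_n$ of LPMs on $[n]$ with $M_i$ of rank $i$. Its flag matroid polytope is the Minkowski sum $P_{M_1}+\cdots+P_{M_n}\subset\mathbb{R}^n$, where $P_{M}=\mathrm{conv}\{e_B: B\text{ a basis of }M\}$ and $e_B$ is the indicator vector of $B$. *)

theory Defs
  imports "HOL-Analysis.Analysis" "HOL-Combinatorics.Permutations" "HOL-Library.Set_Algebras"
begin

text \<open>
  The space \<open>\<real>\<^sup>n\<close> is \<open>real ^ 'n\<close> with \<open>n = CARD('n)\<close>. The combinatorial objects live on
  \<open>{1..n}\<close>; the linear order of the index type identifies it with \<open>{1..n}\<close>.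
\<close>

definition coord_index :: "'n::{finite,linorder} \<Rightarrow> nat" where
  "coord_index i = card {j. j \<le> i}"

lemma coord_index_strict_mono: "strict_mono (coord_index :: 'n::{finite,linorder} \<Rightarrow> nat)"
proof (rule strict_monoI)
  fix x y :: 'n assume "x < y"
  then have "{j. j \<le> x} \<subset> {j. j \<le> y}" by (intro psubsetI subsetI) (auto dest: order_le_less_trans set_eq_iff[THEN iffD1, rule_format, of _ _ y])
  then show "coord_index x < coord_index y"
    unfolding coord_index_def by (rule psubset_card_mono[rotated]) simp
qed

lemma coord_index_bij:
  "bij_betw (coord_index :: 'n::{finite,linorder} \<Rightarrow> nat) UNIV {1..CARD('n)}"
proof -
  let ?f = "coord_index :: 'n \<Rightarrow> nat"
  have inj: "inj ?f" by (rule strict_mono_imp_inj_on[OF coord_index_strict_mono])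
  have "1 \<le> ?f i" for i
  proof -
    have "{j. j \<le> i} \<noteq> {}" by auto
    then show ?thesis unfolding coord_index_def by (simp add: Suc_le_eq card_gt_0_iff)
  qed
  moreover have "?f i \<le> CARD('n)" for i
    unfolding coord_index_def by (rule card_mono) auto
  ultimately have sub: "range ?f \<subseteq> {1..CARD('n)}" by auto
  have "range ?f = {1..CARD('n)}"
    by (rule card_subset_eq[OF _ sub]) (simp_all add: card_image[OF inj])
  with inj show ?thesis by (simp add: bij_betw_def)
qed

section \<open>Permutations and the Bruhat order\<close>

definition perm_length :: "nat \<Rightarrow> (nat \<Rightarrow> nat) \<Rightarrow> nat" where
  "perm_length n z = card {(i, j). i \<in> {1..n} \<and> j \<in> {1..n} \<and> i < j \<and> z j < z i}"

definition bruhat_step :: "nat \<Rightarrow> (nat \<Rightarrow> nat) \<Rightarrow> (nat \<Rightarrow> nat) \<Rightarrow> bool" where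
  "bruhat_step n u v \<longleftrightarrow>
     (\<exists>a\<in>{1..n}. \<exists>b\<in>{1..n}. a \<noteq> b \<and> v = u \<circ> Transposition.transpose a b \<and> perm_length n u < perm_length n v)"

definition bruhat_le :: "nat \<Rightarrow> (nat \<Rightarrow> nat) \<Rightarrow> (nat \<Rightarrow> nat) \<Rightarrow> bool" where
  "bruhat_le n u v \<longleftrightarrow> u permutes {1..n} \<and> v permutes {1..n} \<and> (bruhat_step n)\<^sup>*\<^sup>* u v"

definition perm_point :: "(nat \<Rightarrow> nat) \<Rightarrow> real ^ 'n::{finite,linorder}" where
  "perm_point z = (\<chi> i. real (z (coord_index i)))"

definition permutahedron :: "(real ^ 'n::{finite,linorder}) set" where
  "permutahedron = convex hull (perm_point ` {z. z permutes {1..CARD('n)}})"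

definition bruhat_interval_polytope ::
    "(nat \<Rightarrow> nat) \<Rightarrow> (nat \<Rightarrow> nat) \<Rightarrow> (real ^ 'n::{finite,linorder}) set" where
  "bruhat_interval_polytope u v =
     convex hull (perm_point ` {z. bruhat_le CARD('n) u z \<and> bruhat_le CARD('n) z v})"

definition is_BIP :: "(real ^ 'n::{finite,linorder}) set \<Rightarrow> bool" where
  "is_BIP P \<longleftrightarrow> (\<exists>u v. bruhat_le CARD('n) u v \<and> P = bruhat_interval_polytope u v)"

section \<open>Splits of polytopes\<close>

text \<open>As usual for \<^const>\<open>face_of\<close>, the empty set is a face, so it is a cell.\<close>

definition polytopal_subdivision :: "'a::euclidean_space set set \<Rightarrow> 'a set \<Rightarrow> bool" where
  "polytopal_subdivision \<C> P \<longleftrightarrow>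
     finite \<C> \<and>
     (\<forall>C\<in>\<C>. polytope C) \<and>
     (\<forall>C\<in>\<C>. \<forall>F. F face_of C \<longrightarrow> F \<in> \<C>) \<and>
     (\<forall>C\<in>\<C>. \<forall>D\<in>\<C>. (C \<inter> D) face_of C \<and> (C \<inter> D) face_of D) \<and>
     \<Union>\<C> = P"

definition maximal_cells :: "'a set set \<Rightarrow> 'a set set" where
  "maximal_cells \<C> = {C \<in> \<C>. \<forall>D\<in>\<C>. C \<subseteq> D \<longrightarrow> C = D}"

text \<open>
  \<open>split_along P a b F\<^sub>1 F\<^sub>2\<close>: the polytope \<open>P\<close> has a split with maximal cells \<open>F\<^sub>1\<close>, \<open>F\<^sub>2\<close> and
  split hyperplane \<open>{x. a \<bullet> x = b}\<close>.
\<close>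

definition split_along ::
    "'a::euclidean_space set \<Rightarrow> 'a \<Rightarrow> real \<Rightarrow> 'a set \<Rightarrow> 'a set \<Rightarrow> bool" where
  "split_along P a b F\<^sub>1 F\<^sub>2 \<longleftrightarrow>
     a \<noteq> 0 \<and>
     F\<^sub>1 = P \<inter> {x. a \<bullet> x \<ge> b} \<and> F\<^sub>2 = P \<inter> {x. a \<bullet> x \<le> b} \<and>
     (\<exists>\<C>. polytopal_subdivision \<C> P \<and>
        (\<forall>C\<in>\<C>. \<forall>x. x extreme_point_of C \<longrightarrow> x extreme_point_of P) \<and>
        maximal_cells \<C> = {F\<^sub>1, F\<^sub>2} \<and> F\<^sub>1 \<noteq> F\<^sub>2 \<and>
        F\<^sub>1 \<inter> F\<^sub>2 \<in> \<C> \<and> aff_dim (F\<^sub>1 \<inter> F\<^sub>2) = aff_dim P - 1 \<and>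
        F\<^sub>1 \<inter> F\<^sub>2 \<subseteq> {x. a \<bullet> x = b})"

section \<open>Matroids, given by ground set and set of bases\<close>

definition matroid :: "'a set \<Rightarrow> 'a set set \<Rightarrow> bool" where
  "matroid E \<B> \<longleftrightarrow>
     finite E \<and> \<B> \<noteq> {} \<and> (\<forall>B\<in>\<B>. B \<subseteq> E) \<and>
     (\<forall>A\<in>\<B>. \<forall>B\<in>\<B>. \<forall>x\<in>A - B. \<exists>y\<in>B - A. insert y (A - {x}) \<in> \<B>)"

definition matroid_indep :: "'a set set \<Rightarrow> 'a set \<Rightarrow> bool" where
  "matroid_indep \<B> I \<longleftrightarrow> (\<exists>B\<in>\<B>. I \<subseteq> B)"

definition matroid_rank :: "'a set set \<Rightarrow> 'a set \<Rightarrow> nat" where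
  "matroid_rank \<B> X = Max (card ` {I. matroid_indep \<B> I \<and> I \<subseteq> X})"

definition matroid_flat :: "'a set \<Rightarrow> 'a set set \<Rightarrow> 'a set \<Rightarrow> bool" where
  "matroid_flat E \<B> F \<longleftrightarrow>
     F \<subseteq> E \<and> (\<forall>x\<in>E - F. matroid_rank \<B> F < matroid_rank \<B> (insert x F))"

definition matroid_quotient :: "'a set \<Rightarrow> 'a set set \<Rightarrow> 'a set set \<Rightarrow> bool" where
  "matroid_quotient E M N \<longleftrightarrow>
     matroid E M \<and> matroid E N \<and> (\<forall>F. matroid_flat E M F \<longrightarrow> matroid_flat E N F)"

section \<open>Lattice path matroids and their flags\<close>

definition gale_le :: "nat set \<Rightarrow> nat set \<Rightarrow> bool" where
  "gale_le U L \<longleftrightarrow> finite U \<and> finite L \<and> card U = card L \<and>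
     (\<forall>i<card U. sorted_list_of_set U ! i \<le> sorted_list_of_set L ! i)"

definition lattice_path_matroid :: "nat \<Rightarrow> nat set \<Rightarrow> nat set \<Rightarrow> nat set set" where
  "lattice_path_matroid n U L = {B. B \<subseteq> {1..n} \<and> gale_le U B \<and> gale_le B L}"

definition is_LPM :: "nat \<Rightarrow> nat set set \<Rightarrow> bool" where
  "is_LPM n M \<longleftrightarrow>
     (\<exists>U L. U \<subseteq> {1..n} \<and> L \<subseteq> {1..n} \<and> gale_le U L \<and> M = lattice_path_matroid n U L)"

definition is_LPFM :: "nat \<Rightarrow> (nat \<Rightarrow> nat set set) \<Rightarrow> bool" where
  "is_LPFM n M \<longleftrightarrow>
     (\<forall>i\<in>{1..n}. is_LPM n (M i) \<and> matroid_rank (M i) {1..n} = i) \<and>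
     (\<forall>i\<in>{1..<n}. matroid_quotient {1..n} (M i) (M (Suc i)))"

definition indicator_point :: "nat set \<Rightarrow> real ^ 'n::{finite,linorder}" where
  "indicator_point B = (\<chi> i. if coord_index i \<in> B then 1 else 0)"

definition matroid_polytope :: "nat set set \<Rightarrow> (real ^ 'n::{finite,linorder}) set" where
  "matroid_polytope M = convex hull (indicator_point ` M)"

text \<open>The sum below is the Minkowski sum of sets of \<^theory>\<open>HOL-Library.Set_Algebras\<close>.\<close>

definition flag_matroid_polytope ::
    "(nat \<Rightarrow> nat set set) \<Rightarrow> (real ^ 'n::{finite,linorder}) set" where
  "flag_matroid_polytope M = (\<Sum>i\<in>{1..CARD('n)}. matroid_polytope (M i))"

definition is_LPFM_polytope :: "(real ^ 'n::{finite,linorder}) set \<Rightarrow> bool" where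
  "is_LPFM_polytope P \<longleftrightarrow> (\<exists>M. is_LPFM CARD('n) M \<and> P = flag_matroid_polytope M)"

section \<open>The hyperplanes\<close>

text \<open>Coefficient vector of the linear form \<open>x\<^sub>1 + \<dots> + x\<^sub>j\<close>.\<close>

definition prefix_vec :: "nat \<Rightarrow> real ^ 'n::{finite,linorder}" where
  "prefix_vec j = (\<chi> i. if coord_index i \<le> j then 1 else 0)"

lemma inner_prefix_vec: "prefix_vec j \<bullet> x = (\<Sum>i | coord_index i \<le> j. x $ i)"
  by (simp add: prefix_vec_def inner_vec_def if_distrib[of "\<lambda>c. c * _"] sum.If_cases cong: if_cong)

lemma sum_prefix_min_succ: "1 \<le> j \<Longrightarrow> (\<Sum>m\<in>{1..<j} \<union> {j + 1}. m) = (j + 1 choose 2) + 1"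
  using gauss_sum_from_Suc_0[of "j", where ?'a = nat]
  by (cases j) (auto simp: choose_two atLeastLessThanSuc_atLeastAtMost atLeastAtMostSuc_conv)

lemma sum_prefix_max_pred:
  fixes n j :: nat
  assumes "1 \<le> j" "j \<le> n"
  shows "(\<Sum>m\<in>{n - j} \<union> {n - j + 2..n}. m) = (\<Sum>k<j - 1. n - k) + (n - j)"
proof -
  have "(\<Sum>k<j - 1. n - k) = (\<Sum>m\<in>{n - j + 2..n}. m)"
    by (rule sum.reindex_bij_witness[of _ "\<lambda>m. n - m" "\<lambda>k. n - k"]) (use assms in auto)
  then show ?thesis by simp
qed

end

theory Submission
  imports Defs
begin

text \<open>
The proof has three independent ideas.

\<^emph>\<open>The hyperplanes split.\<close> An edge of the permutahedron exchanges two consecutive values of a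
permutation, so a linear form \<open>x(A) = \<Sum>i\<in>A. x\<^sub>i\<close> changes by at most one along an edge. No edge
crosses a hyperplane \<open>x(A) = b\<close> with integral \<open>b\<close>, so that the slice has only permutations as
vertices. The edges need not be described for this: if \<open>c\<close> is an arbitrary linear functional and \<open>t\<close>
grows, then the permutations that maximise \<open>c + t x(A)\<close> change by exchanging consecutive values one
pair at a time, and some maximiser satisfies \<open>x(A) = b\<close> (\<open>exists_level_maximiser\<close>). Separating
a point of the slice from the permutations in it is therefore impossible (\<open>permutahedron_slice\<close>).
The faces of the two halves then form a split (\<open>split_alongI\<close>).

\<^emph>\<open>The halves are Bruhat intervals.\<close> On the permutahedron every hyperplane of the theorem has the
form \<open>x\<^sub>1 + \<dots> + x\<^sub>j = b\<close>; for the last coordinate one takes \<open>j = n - 1\<close>, since the sum of all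
coordinates is constant. In all cases there is exactly one set \<open>A\<close> of \<open>j\<close> values with sum \<open>b\<close>. A
permutation with prefix sum at least \<open>b\<close> can be moved down in Bruhat order within the half unless
its prefix sum is exactly \<open>b\<close> and it increases on the first \<open>j\<close> and on the last \<open>n - j\<close>
positions. There is only one such permutation, because its prefix values must be \<open>A\<close>; it is the
least element of the half (\<open>ex_bruhat_least_of_unique_prefix\<close>). The other half follows by
complementing values.

\<^emph>\<open>The halves are flag matroid polytopes.\<close> Let \<open>k\<^sub>i\<close> be the number of elements of \<open>A\<close> among the \<open>i\<close>
largest values, so that \<open>\<Sum>i. k\<^sub>i = b\<close>. The bases of the \<open>i\<close>-th matroid are the \<open>i\<close>-sets with at
least \<open>k\<^sub>i\<close> elements among the first \<open>j\<close> positions (for the other half, at least \<open>i - k\<^sub>i\<close>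
elements among the last \<open>n - j\<close> positions). These are lattice path matroids, and consecutive ones
are quotients by inspection of their rank functions. Their Minkowski sum lies in the permutahedron,
which is the sum of all hypersimplices, and in the correct half-space since \<open>\<Sum>i. k\<^sub>i = b\<close>.
Conversely, a permutation is the sum of the indicator vectors of its sets of \<open>i\<close> top positions, and
these are bases because their number of elements among the first \<open>j\<close> positions is monotone in Bruhat
order (\<open>is_LPFM_polytope_halfspace\<close>, \<open>split_of_unique_prefix_set\<close>).
\<close>

section \<open>Permutations that maximise a linear functional\<close>

lemma sum_exchange_le:
  fixes w :: "'a \<Rightarrow> 'b::ordered_comm_monoid_add"
  assumes fin: "finite B" "finite T" and card: "card B = card T"
    and le: "\<And>b t. b \<in> B - T \<Longrightarrow> t \<in> T - B \<Longrightarrow> w b \<le> w t"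
  shows "sum w B \<le> sum w T"
proof -
  have "card (B - T) = card (T - B)"
    using card_Diff_subset_Int[of B T] card_Diff_subset_Int[of T B] fin card
    by (simp add: Int_commute)
  then obtain h where h: "bij_betw h (B - T) (T - B)"
    using finite_same_card_bij[of "B - T" "T - B"] fin by auto
  have "sum w (B - T) \<le> (\<Sum>b\<in>B - T. w (h b))"
    using h le by (intro sum_mono) (auto simp: bij_betw_def)
  also have "\<dots> = sum w (T - B)"
    by (rule sum.reindex_bij_betw[OF h])
  finally have "sum w (B \<inter> T) + sum w (B - T) \<le> sum w (T \<inter> B) + sum w (T - B)"
    by (simp add: Int_commute add_left_mono)
  then show ?thesis
    using fin by (simp flip: sum.Int_Diff)
qed

text \<open>
The \<open>i\<close>-th member of the full flag of sets that the permutation \<open>z\<close> determines.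
\<close>

definition top_positions :: "nat \<Rightarrow> (nat \<Rightarrow> nat) \<Rightarrow> nat \<Rightarrow> nat set" where
  "top_positions n z i = {k \<in> {1..n}. n - i < z k}"

lemma top_positions_subset: "top_positions n z i \<subseteq> {1..n}"
  by (auto simp: top_positions_def)

lemma card_top_positions:
  assumes z: "z permutes {1..n}" and "i \<le> n"
  shows "card (top_positions n z i) = i"
proof -
  have inj: "inj_on z (top_positions n z i)"
    using permutes_inj[OF z] by (rule inj_on_subset) simp
  have "z ` top_positions n z i = {n - i<..n}"
  proof (intro equalityI subsetI)
    fix v assume "v \<in> {n - i<..n}"
    then have "v \<in> z ` {1..n}" using permutes_image[OF z] by auto
    with \<open>v \<in> {n - i<..n}\<close> show "v \<in> z ` top_positions n z i"
      by (auto simp: top_positions_def)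
  qed (use permutes_in_image[OF z] in \<open>auto simp: top_positions_def\<close>)
  then show ?thesis using card_image[OF inj] \<open>i \<le> n\<close> by simp
qed

text \<open>
A position \<open>k\<close> lies in exactly \<open>z k\<close> of the sets of top positions. In other words, the point of a
permutation is the sum of the indicator vectors of its flag.
\<close>

lemma sum_top_positions:
  fixes w :: "nat \<Rightarrow> real"
  assumes z: "z permutes {1..n}"
  shows "(\<Sum>i\<in>{1..n}. sum w (top_positions n z i)) = (\<Sum>k\<in>{1..n}. w k * real (z k))"
proof -
  have "(\<Sum>i\<in>{1..n}. sum w (top_positions n z i))
      = (\<Sum>i\<in>{1..n}. \<Sum>k\<in>{1..n}. if n - i < z k then w k else 0)"
    unfolding top_positions_def by (intro sum.cong refl sum.inter_filter) simp
  also have "\<dots> = (\<Sum>k\<in>{1..n}. \<Sum>i\<in>{1..n}. if n - i < z k then w k else 0)"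
    by (rule sum.swap)
  also have "\<dots> = (\<Sum>k\<in>{1..n}. w k * real (z k))"
  proof (intro sum.cong refl)
    fix k assume k: "k \<in> {1..n}"
    then have zk: "z k \<in> {1..n}" using permutes_in_image[OF z] by blast
    have "(\<Sum>i\<in>{1..n}. if n - i < z k then w k else 0) = (\<Sum>i\<in>{i\<in>{1..n}. n - i < z k}. w k)"
      by (rule sum.inter_filter[symmetric]) simp
    also have "{i\<in>{1..n}. n - i < z k} = {n + 1 - z k..n}" using zk by auto
    finally show "(\<Sum>i\<in>{1..n}. if n - i < z k then w k else 0) = w k * real (z k)"
      using zk by simp
  qed
  finally show ?thesis .
qed

text \<open>
If \<open>z\<close> is larger where the weights are larger, then its top positions form a heaviest set of their
size. It suffices to compare the weights of positions with consecutive values, which is what an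
exchange argument gives. The result is used twice: summed over \<open>i\<close> for the flag of another
permutation it is the rearrangement inequality, and applied to arbitrary sets it bounds a Minkowski
sum of matroid polytopes.
\<close>

lemma top_positions_maximise:
  fixes w :: "nat \<Rightarrow> real"
  assumes z: "z permutes {1..n}"
    and adj: "\<And>k l. k \<in> {1..n} \<Longrightarrow> l \<in> {1..n} \<Longrightarrow> z l = Suc (z k) \<Longrightarrow> w k \<le> w l"
    and B: "B \<subseteq> {1..n}"
  shows "sum w B \<le> sum w (top_positions n z (card B))"
proof -
  have mono_aux: "w k \<le> w l" if "k \<in> {1..n}" "l \<in> {1..n}" "z l = z k + d" for k l d
    using that
  proof (induction d arbitrary: l)
    case 0
    then show ?case using permutes_inj[OF z] by (auto dest: injD)
  next
    case (Suc d)
    have "z k \<in> {1..n}" "z l \<in> {1..n}"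
      using permutes_in_image[OF z] Suc.prems by blast+
    then have "z k + d \<in> {1..n}" using Suc.prems(3) by auto
    then obtain l' where l': "l' \<in> {1..n}" "z l' = z k + d"
      using permutes_image[OF z] by (metis imageE)
    have "w k \<le> w l'" using Suc.IH Suc.prems(1) l' by blast
    also have "w l' \<le> w l" using adj[of l' l] l' Suc.prems by simp
    finally show ?case .
  qed
  have mono: "w k \<le> w l" if "k \<in> {1..n}" "l \<in> {1..n}" "z k \<le> z l" for k l
    using mono_aux[OF that(1,2), of "z l - z k"] that(3) by simp
  show ?thesis
  proof (rule sum_exchange_le)
    show "finite B" using B finite_subset by blast
    show "card B = card (top_positions n z (card B))"
      using card_top_positions[OF z, of "card B"] card_mono[OF _ B] by simp
    show "w b \<le> w t"
      if "b \<in> B - top_positions n z (card B)" "t \<in> top_positions n z (card B) - B" for b t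
      using that B by (intro mono) (auto simp: top_positions_def subset_iff)
  qed (simp add: top_positions_def)
qed

lemma sorted_weights_maximise:
  fixes w :: "nat \<Rightarrow> real"
  assumes z: "z permutes {1..n}"
    and adj: "\<And>k l. k \<in> {1..n} \<Longrightarrow> l \<in> {1..n} \<Longrightarrow> z l = Suc (z k) \<Longrightarrow> w k \<le> w l"
    and y: "y permutes {1..n}"
  shows "(\<Sum>k\<in>{1..n}. w k * real (y k)) \<le> (\<Sum>k\<in>{1..n}. w k * real (z k))"
  unfolding sum_top_positions[OF z, symmetric] sum_top_positions[OF y, symmetric]
proof (rule sum_mono)
  fix i assume "i \<in> {1..n}"
  then show "sum w (top_positions n y i) \<le> sum w (top_positions n z i)"
    using top_positions_maximise[OF z adj top_positions_subset[of n y i]] card_top_positions[OF y, of i]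
    by simp
qed

lemma sum_transpose:
  fixes w :: "'a \<Rightarrow> real"
  assumes "finite S" "k \<in> S" "l \<in> S" "k \<noteq> l"
  shows "(\<Sum>x\<in>S. w x * real ((z \<circ> Transposition.transpose k l) x))
       = (\<Sum>x\<in>S. w x * real (z x)) + (w k - w l) * (real (z l) - real (z k))"
proof -
  have split: "sum g S = g k + (g l + sum g (S - {k} - {l}))" for g :: "'a \<Rightarrow> real"
    using assms by (simp add: sum.remove[of S k] sum.remove[of "S - {k}" l])
  have "(\<Sum>x\<in>S - {k} - {l}. w x * real ((z \<circ> Transposition.transpose k l) x))
      = (\<Sum>x\<in>S - {k} - {l}. w x * real (z x))"
    by (intro sum.cong) (auto simp: Transposition.transpose_def)
  then show ?thesis
    using assms by (simp add: split[of "\<lambda>x. w x * real ((z \<circ> Transposition.transpose k l) x)"]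
      split[of "\<lambda>x. w x * real (z x)"] algebra_simps del: comp_apply) (simp add: algebra_simps)
qed

lemma permutes_comp_transpose:
  assumes "z permutes S" "k \<in> S" "l \<in> S"
  shows "(z \<circ> Transposition.transpose k l) permutes S"
  using assms by (intro permutes_compose permutes_swap_id)

lemma exists_sorting_permutation:
  fixes w :: "nat \<Rightarrow> real"
  shows "\<exists>z. z permutes {1..n} \<and>
    (\<forall>k\<in>{1..n}. \<forall>l\<in>{1..n}. z l = Suc (z k) \<longrightarrow> w k \<le> w l)"
proof -
  define P where "P = {z. z permutes {1..n}}"
  define f where "f z = (\<Sum>k\<in>{1..n}. w k * real (z k))" for z :: "nat \<Rightarrow> nat"
  have P: "finite P" "id \<in> P" by (simp_all add: P_def finite_permutations permutes_id)
  then have "Max (f ` P) \<in> f ` P" by (intro Max_in) auto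
  then obtain z where z: "z \<in> P" "f z = Max (f ` P)" by auto
  then have zp: "z permutes {1..n}" by (simp add: P_def)
  have "w k \<le> w l" if kl: "k \<in> {1..n}" "l \<in> {1..n}" "z l = Suc (z k)" for k l
  proof -
    have "k \<noteq> l" using kl by auto
    have "z \<circ> Transposition.transpose k l \<in> P"
      using permutes_comp_transpose[OF zp kl(1,2)] by (simp add: P_def)
    then have "f (z \<circ> Transposition.transpose k l) \<le> f z" using z(2) P(1) by simp
    moreover have "f (z \<circ> Transposition.transpose k l)
        = f z + (w k - w l) * (real (z l) - real (z k))"
      unfolding f_def by (rule sum_transpose[OF finite_atLeastAtMost kl(1,2) \<open>k \<noteq> l\<close>])
    ultimately show ?thesis using kl(3) by simp
  qed
  then show ?thesis using zp by blast
qed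

text \<open>
Among the maximisers of \<open>c + t x(A)\<close>, for suitable \<open>t\<close>, there is one with \<open>x(A) = b\<close>. Take the
largest \<open>t\<close> for which some maximiser has \<open>x(A) \<le> b\<close>, and such a maximiser with \<open>x(A)\<close> as large as
possible. If it stayed below \<open>b\<close>, then no consecutive values with equal weight could be exchanged
towards \<open>A\<close>, because that would raise \<open>x(A)\<close> by one. So \<open>z\<close> would remain a maximiser for slightly
larger \<open>t\<close>, contrary to the choice of \<open>t\<close>.
\<close>

lemma exists_level_maximiser:
  fixes c :: "nat \<Rightarrow> real" and n b :: nat and A :: "nat set" and h :: "(nat \<Rightarrow> nat) \<Rightarrow> real"
  defines "P \<equiv> {z. z permutes {1..n}}"
  defines "h \<equiv> \<lambda>z. \<Sum>k\<in>{1..n}. of_bool (k \<in> A) * real (z k)"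
  assumes lo: "zlo \<in> P" "h zlo < b" and hi: "zhi \<in> P" "b < h zhi"
  obtains t z where "z \<in> P" "h z = real b"
    "\<forall>z'\<in>P. (\<Sum>k\<in>{1..n}. (c k + t * of_bool (k \<in> A)) * real (z' k))
                     \<le> (\<Sum>k\<in>{1..n}. (c k + t * of_bool (k \<in> A)) * real (z k))"
proof -
  define g where "g = (\<lambda>z::nat\<Rightarrow>nat. \<Sum>k\<in>{1..n}. c k * real (z k))"
  define opt where "opt t z \<longleftrightarrow> z \<in> P \<and> (\<forall>z'\<in>P. g z' + t * h z' \<le> g z + t * h z)" for t z
  have lin: "(\<Sum>k\<in>{1..n}. (c k + t * of_bool (k \<in> A)) * real (z k)) = g z + t * h z" for t z
    unfolding g_def h_def sum_distrib_left sum.distrib[symmetric]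
    by (intro sum.cong refl) (simp add: algebra_simps)
  have finP: "finite P" by (simp add: P_def finite_permutations)
  define G where "G = Max (g ` P)"
  have G: "g z \<le> G" if "z \<in> P" for z using that finP by (simp add: G_def)
  have ex_opt: "\<exists>z. opt t z" for t
  proof -
    have "Max ((\<lambda>z. g z + t * h z) ` P) \<in> (\<lambda>z. g z + t * h z) ` P"
      using finP lo by (intro Max_in) auto
    then obtain z where "z \<in> P" "g z + t * h z = Max ((\<lambda>z. g z + t * h z) ` P)" by auto
    then show ?thesis using finP by (auto simp: opt_def)
  qed
  define T where "T = {t. \<exists>z. opt t z \<and> h z \<le> b}"
  have "T = (\<Union>z\<in>{z\<in>P. h z \<le> b}. \<Inter>z'\<in>P. {t. g z' + t * h z' \<le> g z + t * h z})"
    by (auto simp: T_def opt_def)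
  moreover have "closed \<dots>"
    using finP by (intro closed_UN closed_INT ballI closed_Collect_le continuous_intros) auto
  ultimately have "closed T" by simp
  moreover have "T \<noteq> {}"
  proof -
    \<comment> \<open>At the parameter \<open>- r\<close>, a maximiser above level \<open>b\<close> would be beaten by \<open>zlo\<close>.\<close>
    define r where "r = (G - g zlo + 1) / (b - h zlo)"
    have r: "0 \<le> r" "r * (b - h zlo) = G - g zlo + 1"
      using G[OF lo(1)] lo(2) by (simp_all add: r_def)
    obtain z where z: "opt (- r) z" using ex_opt by blast
    then have "g zlo + - r * h zlo \<le> g z + - r * h z" "g z \<le> G"
      using lo(1) G unfolding opt_def by blast+
    then have "r * (h z - h zlo) < r * (b - h zlo)"
      unfolding r(2) by (simp add: right_diff_distrib)
    then have "h z \<le> b" using r(1) by (simp add: mult_less_cancel_left)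
    then have "- r \<in> T" using z unfolding T_def by blast
    then show ?thesis by blast
  qed
  moreover have bdd: "bdd_above T"
  proof (rule bdd_aboveI)
    fix t assume "t \<in> T"
    then obtain z where z: "opt t z" "h z \<le> b" unfolding T_def by blast
    \<comment> \<open>Conversely, for large parameters every maximiser at or below level \<open>b\<close> is beaten by \<open>zhi\<close>.\<close>
    show "t \<le> max 0 ((G - g zhi) / (h zhi - b))"
    proof (cases "t \<le> 0")
      case False
      have "g zhi + t * h zhi \<le> g z + t * h z" "g z \<le> G"
        using z hi G by (auto simp: opt_def)
      moreover have "t * (h zhi - b) \<le> t * (h zhi - h z)"
        using False z by (intro mult_left_mono) auto
      ultimately have "t * (h zhi - b) \<le> G - g zhi" by (simp add: algebra_simps)
      then show ?thesis using hi by (simp add: pos_le_divide_eq le_max_iff_disj)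
    qed simp
  qed
  ultimately have "Sup T \<in> T" by (intro closed_contains_Sup)
  define t where "t = Sup T"
  let ?Z = "{z. opt t z \<and> h z \<le> b}"
  have "finite ?Z" by (rule finite_subset[OF _ finP]) (auto simp: opt_def)
  moreover have "?Z \<noteq> {}" using \<open>Sup T \<in> T\<close> unfolding T_def t_def by blast
  ultimately have Z: "finite ?Z" "?Z \<noteq> {}" .
  then have "Max (h ` ?Z) \<in> h ` ?Z" by (intro Max_in) auto
  then obtain z where z: "opt t z" "h z \<le> b" "h z = Max (h ` ?Z)" by auto
  have zmax: "h z' \<le> h z" if "opt t z'" "h z' \<le> b" for z'
    using that Z z(3) by auto
  have zP: "z permutes {1..n}" using z by (auto simp: opt_def P_def)
  have "h z = b"
  proof (rule ccontr)
    assume "h z \<noteq> b"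
    define w where "w k = c k + t * of_bool (k \<in> A)" for k
    obtain N where N: "h z = real N"
    proof
      show "h z = real (\<Sum>k\<in>{1..n}. of_bool (k \<in> A) * z k)"
        unfolding h_def of_nat_sum by (intro sum.cong) auto
    qed
    then have "Suc N \<le> b" using \<open>h z \<noteq> b\<close> \<open>h z \<le> b\<close> by simp
    then have "real (Suc N) \<le> real b" by (simp only: of_nat_le_iff)
    then have step: "h z + 1 \<le> b" using N by simp
    have linw: "(\<Sum>k\<in>{1..n}. w k * real (z k)) = g z + t * h z" for z
      unfolding w_def lin ..
    have adj: "w k \<le> w l \<and> (k \<in> A \<and> l \<notin> A \<longrightarrow> w k < w l)"
      if kl: "k \<in> {1..n}" "l \<in> {1..n}" "z l = Suc (z k)" for k l
    proof -
      define y where "y = z \<circ> Transposition.transpose k l"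
      have "k \<noteq> l" using kl by auto
      have zP': "y \<in> P" using permutes_comp_transpose[OF zP kl(1,2), folded y_def] by (simp add: P_def)
      have val: "g y + t * h y = g z + t * h z + (w k - w l)"
        using sum_transpose[OF _ kl(1,2) \<open>k \<noteq> l\<close>, of w z, folded y_def] kl(3) unfolding linw by simp
      then have le: "w k \<le> w l" using z zP' by (auto simp: opt_def)
      moreover have "w k \<noteq> w l" if "k \<in> A" "l \<notin> A"
      proof
        assume "w k = w l"
        then have "opt t y" using val z zP' by (simp add: opt_def)
        moreover have "h y = h z + (of_bool (k \<in> A) - of_bool (l \<in> A)) * (real (z l) - real (z k))"
          unfolding h_def y_def by (rule sum_transpose[OF finite_atLeastAtMost kl(1,2) \<open>k \<noteq> l\<close>])
        then have "h y = h z + 1" using kl(3) that by simp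
        ultimately show False using zmax[of y] step by simp
      qed
      ultimately show ?thesis by auto
    qed
    let ?D = "{w l - w k | k l. k \<in> {1..n} \<and> l \<in> {1..n} \<and> w k < w l}"
    have finD: "finite ?D"
      by (rule finite_subset[of _ "(\<lambda>(k, l). w l - w k) ` ({1..n} \<times> {1..n})"]) auto
    \<comment> \<open>An increase of the parameter that does not exceed any positive gap between two weights.\<close>
    define e where "e = Min (insert 1 ?D)"
    have "e \<in> insert 1 ?D" unfolding e_def using finD by (intro Min_in) auto
    then have "e > 0" by auto
    have e: "e \<le> w l - w k" if "k \<in> {1..n}" "l \<in> {1..n}" "w k < w l" for k l
      unfolding e_def using finD that by (intro Min_le) auto
    have "opt (t + e) z"
      unfolding opt_def
    proof (intro conjI ballI)
      fix z' assume "z' \<in> P"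
      then have z': "z' permutes {1..n}" by (simp add: P_def)
      have "(\<Sum>k\<in>{1..n}. (c k + (t + e) * of_bool (k \<in> A)) * real (z' k))
          \<le> (\<Sum>k\<in>{1..n}. (c k + (t + e) * of_bool (k \<in> A)) * real (z k))"
      proof (rule sorted_weights_maximise[OF zP])
        fix k l assume kl: "k \<in> {1..n}" "l \<in> {1..n}" "z l = Suc (z k)"
        then show "c k + (t + e) * of_bool (k \<in> A) \<le> c l + (t + e) * of_bool (l \<in> A)"
          using adj[OF kl] e[OF kl(1,2)] \<open>e > 0\<close>
          by (cases "k \<in> A"; cases "l \<in> A") (auto simp: w_def algebra_simps)
      qed (rule z')
      then show "g z' + (t + e) * h z' \<le> g z + (t + e) * h z"
        unfolding lin .
    qed (use zP in \<open>simp add: P_def\<close>)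
    then have "t + e \<in> T" using z unfolding T_def by blast
    then have "t + e \<le> t" unfolding t_def using bdd by (rule cSup_upper)
    with \<open>e > 0\<close> show False by simp
  qed
  show ?thesis
  proof (rule that)
    show "z \<in> P" using z(1) by (simp add: opt_def)
    show "h z = real b" by fact
    show "\<forall>z'\<in>P. (\<Sum>k\<in>{1..n}. (c k + t * of_bool (k \<in> A)) * real (z' k))
             \<le> (\<Sum>k\<in>{1..n}. (c k + t * of_bool (k \<in> A)) * real (z k))"
      using z(1) unfolding lin opt_def by blast
  qed
qed

section \<open>Splits without new vertices\<close>

lemma hyperplane_crossing:
  fixes a p q :: "'a::real_inner"
  assumes "b < a \<bullet> p" "a \<bullet> q < b"
  obtains u where "0 < u" "u < 1" "a \<bullet> ((1 - u) *\<^sub>R p + u *\<^sub>R q) = b"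
proof
  define u where "u = (a \<bullet> p - b) / (a \<bullet> p - a \<bullet> q)"
  have "u * (a \<bullet> p - a \<bullet> q) = a \<bullet> p - b" using assms by (simp add: u_def)
  then show "a \<bullet> ((1 - u) *\<^sub>R p + u *\<^sub>R q) = b"
    by (simp add: inner_add_right algebra_simps)
  show "0 < u" "u < 1" using assms by (auto simp: u_def)
qed

text \<open>
If the hyperplane section creates no new vertices, then neither does a half. The points of the hull
that lie below the hyperplane, together with the hull of the vertices on or above it, form a convex set:
a segment from one part to the other crosses the hyperplane inside the section.
\<close>

lemma convex_hull_Int_halfspace_ge:
  fixes V :: "'a::euclidean_space set"
  assumes H: "convex hull V \<inter> {x. a \<bullet> x = b} \<subseteq> convex hull (V \<inter> {x. a \<bullet> x = b})"
  shows "convex hull V \<inter> {x. a \<bullet> x \<ge> b} = convex hull (V \<inter> {x. a \<bullet> x \<ge> b})"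
proof
  let ?Q = "convex hull (V \<inter> {x. a \<bullet> x \<ge> b})"
  show "?Q \<subseteq> convex hull V \<inter> {x. a \<bullet> x \<ge> b}"
    by (intro hull_minimal) (auto intro: hull_inc convex_Int convex_halfspace_ge)
  let ?C = "?Q \<union> (convex hull V \<inter> {x. a \<bullet> x < b})"
  have QV: "?Q \<subseteq> convex hull V" by (intro hull_mono) auto
  have HQ: "x \<in> ?Q" if "x \<in> convex hull V" "a \<bullet> x = b" for x
  proof -
    have "x \<in> convex hull (V \<inter> {x. a \<bullet> x = b})" using H that by auto
    also have "\<dots> \<subseteq> ?Q" by (intro hull_mono) auto
    finally show ?thesis .
  qed
  have Qge: "a \<bullet> x \<ge> b" if "x \<in> ?Q" for x
    using that \<open>?Q \<subseteq> convex hull V \<inter> {x. a \<bullet> x \<ge> b}\<close> by auto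
  have mixed: "(1 - u) *\<^sub>R s + u *\<^sub>R t \<in> ?C"
    if s: "s \<in> ?Q" and t: "t \<in> convex hull V" "a \<bullet> t < b" and u: "0 \<le> u" "u \<le> 1" for s t u
  proof (cases "a \<bullet> ((1 - u) *\<^sub>R s + u *\<^sub>R t) < b")
    case True
    moreover have "(1 - u) *\<^sub>R s + u *\<^sub>R t \<in> convex hull V"
      using s t u QV by (intro convexD) (auto simp: convex_convex_hull)
    ultimately show ?thesis by auto
  next
    case False
    show ?thesis
    proof (cases "a \<bullet> s = b \<or> u = 0")
      case True
      have "u = 0"
      proof (rule ccontr)
        assume "u \<noteq> 0"
        then have "a \<bullet> s = b" "u > 0" using True u by auto
        then have "u * (a \<bullet> t) < u * b" using t by simp
        then show False using False \<open>a \<bullet> s = b\<close> by (simp add: inner_add_right algebra_simps)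
      qed
      then show ?thesis using s by simp
    next
      case gt: False
      then have "b < a \<bullet> s" using Qge[OF s] by simp
      from hyperplane_crossing[OF this t(2)] obtain v where
        v: "0 < v" "v < 1" "a \<bullet> ((1 - v) *\<^sub>R s + v *\<^sub>R t) = b" .
      let ?y = "(1 - v) *\<^sub>R s + v *\<^sub>R t"
      have "?y \<in> convex hull V"
        using s t v QV by (intro convexD) (auto simp: convex_convex_hull)
      then have y: "?y \<in> ?Q" using v HQ by blast
      have "(v - u) * (a \<bullet> s - a \<bullet> t) \<ge> 0"
        using False v(3) by (simp add: inner_add_right algebra_simps)
      then have "u \<le> v" using \<open>b < a \<bullet> s\<close> t(2) by (simp add: zero_le_mult_iff)
      then have "0 \<le> u / v" "u / v \<le> 1" using u v by auto
      then have "(1 - u / v) *\<^sub>R s + (u / v) *\<^sub>R ?y \<in> ?Q"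
        by (intro convexD[OF convex_convex_hull s y]) auto
      also have "(1 - u / v) *\<^sub>R s + (u / v) *\<^sub>R ?y = (1 - u) *\<^sub>R s + u *\<^sub>R t"
        using v by (simp add: algebra_simps)
      finally show ?thesis by blast
    qed
  qed
  have "convex ?C"
  proof (rule convexI)
    fix x y :: 'a and u' u :: real
    assume x: "x \<in> ?C" and y: "y \<in> ?C" and "0 \<le> u'" "0 \<le> u" "u' + u = 1"
    then have u: "0 \<le> u \<and> u \<le> 1" and u': "u' = 1 - u" by auto
    have low: "convex (convex hull V \<inter> {x. a \<bullet> x < b})"
      by (intro convex_Int convex_convex_hull convex_halfspace_lt)
    consider "x \<in> ?Q" "y \<in> ?Q" | "x \<in> ?Q" "y \<in> convex hull V \<inter> {x. a \<bullet> x < b}"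
      | "y \<in> ?Q" "x \<in> convex hull V \<inter> {x. a \<bullet> x < b}"
      | "x \<in> convex hull V \<inter> {x. a \<bullet> x < b}" "y \<in> convex hull V \<inter> {x. a \<bullet> x < b}"
      using x y by blast
    then have "(1 - u) *\<^sub>R x + u *\<^sub>R y \<in> ?C"
    proof cases
      case 1 then show ?thesis using u convex_convex_hull[of "V \<inter> {x. a \<bullet> x \<ge> b}"]
        by (auto simp: convex_alt)
    next
      case 2 then show ?thesis using mixed u by blast
    next
      case 3 then show ?thesis using mixed[of y x "1 - u"] u by (simp add: add.commute)
    next
      case 4 then show ?thesis using low u unfolding convex_alt by blast
    qed
    then show "u' *\<^sub>R x + u *\<^sub>R y \<in> ?C" unfolding u' .
  qed
  moreover have "V \<subseteq> ?C" by (auto simp: hull_inc not_less intro: hull_inc)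
  ultimately have "convex hull V \<subseteq> ?C" by (rule hull_minimal[rotated])
  then show "convex hull V \<inter> {x. a \<bullet> x \<ge> b} \<subseteq> ?Q" by auto
qed

lemma convex_hull_Int_halfspace_le:
  fixes V :: "'a::euclidean_space set"
  assumes H: "convex hull V \<inter> {x. a \<bullet> x = b} \<subseteq> convex hull (V \<inter> {x. a \<bullet> x = b})"
  shows "convex hull V \<inter> {x. a \<bullet> x \<le> b} = convex hull (V \<inter> {x. a \<bullet> x \<le> b})"
  using convex_hull_Int_halfspace_ge[of V "-a" "-b"] H by simp

text \<open>
For the lower bound on the dimension, the section and one point \<open>p\<close> strictly above it affinely
generate \<open>P\<close>: the line from \<open>p\<close> to a point below meets the section, and points above are then
reached from a point \<open>q\<close> below.
\<close>

lemma aff_dim_Int_crossing_hyperplane: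
  fixes P :: "'a::euclidean_space set"
  assumes "convex P" and p: "p \<in> P" "b < a \<bullet> p" and q: "q \<in> P" "a \<bullet> q < b"
  shows "aff_dim (P \<inter> {x. a \<bullet> x = b}) = aff_dim P - 1"
proof -
  let ?G = "P \<inter> {x. a \<bullet> x = b}"
  let ?L = "affine hull (insert p ?G)"
  have G: "(1 - u) *\<^sub>R x + u *\<^sub>R y \<in> ?G"
    if "x \<in> P" "y \<in> P" "0 < u" "u < 1" "a \<bullet> ((1 - u) *\<^sub>R x + u *\<^sub>R y) = b" for x y u
    using \<open>convex P\<close> that by (auto simp: convex_alt)
  have line: "y \<in> ?L" if "x \<in> ?L" "(1 - u) *\<^sub>R x + u *\<^sub>R y \<in> ?G" "0 < u" for x y u
  proof -
    have "(1 - u) *\<^sub>R x + u *\<^sub>R y \<in> ?L"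
      using that(2) by (intro hull_inc) blast
    from mem_affine[OF affine_affine_hull that(1) this, of "1 - 1 / u" "1 / u"]
    have "(1 - 1 / u) *\<^sub>R x + (1 / u) *\<^sub>R ((1 - u) *\<^sub>R x + u *\<^sub>R y) \<in> ?L"
      by simp
    also have "(1 - 1 / u) *\<^sub>R x + (1 / u) *\<^sub>R ((1 - u) *\<^sub>R x + u *\<^sub>R y) = y"
      using that by (simp add: algebra_simps)
    finally show ?thesis .
  qed
  have pL: "p \<in> ?L" by (intro hull_inc) auto
  have below: "x \<in> ?L" if x: "x \<in> P" "a \<bullet> x < b" for x
  proof -
    from hyperplane_crossing[OF p(2) x(2)] obtain u where
      "0 < u" "u < 1" "a \<bullet> ((1 - u) *\<^sub>R p + u *\<^sub>R x) = b" .
    then show ?thesis using line[OF pL G] p x by blast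
  qed
  have above: "x \<in> ?L" if x: "x \<in> P" "a \<bullet> x > b" for x
  proof -
    from hyperplane_crossing[OF x(2) q(2)] obtain u where
      u: "0 < u" "u < 1" "a \<bullet> ((1 - u) *\<^sub>R x + u *\<^sub>R q) = b" .
    then have "(1 - (1 - u)) *\<^sub>R q + (1 - u) *\<^sub>R x \<in> ?G"
      using G[OF x(1) q(1)] by (simp add: add.commute)
    from line[OF below[OF q] this] u show ?thesis by simp
  qed
  have "P \<subseteq> ?L"
  proof
    fix x assume x: "x \<in> P"
    show "x \<in> ?L"
      using below[OF x] above[OF x] x
      by (cases "a \<bullet> x" b rule: linorder_cases) (auto intro: hull_inc)
  qed
  then have "aff_dim P \<le> aff_dim (insert p ?G)"
    by (metis aff_dim_subset aff_dim_affine_hull)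
  also have "\<dots> \<le> aff_dim ?G + 1" by (simp add: aff_dim_insert)
  finally have ge: "aff_dim P - 1 \<le> aff_dim ?G" by simp
  have "?G \<subseteq> affine hull P \<inter> {x. a \<bullet> x = b}" by (auto intro: hull_inc)
  then have "aff_dim ?G \<le> aff_dim (affine hull P \<inter> {x. a \<bullet> x = b})" by (rule aff_dim_subset)
  also have "\<dots> = aff_dim P - 1"
  proof -
    obtain u where "0 < u" "u < 1" "a \<bullet> ((1 - u) *\<^sub>R p + u *\<^sub>R q) = b"
      using hyperplane_crossing[OF p(2) q(2)] .
    then have "(1 - u) *\<^sub>R p + u *\<^sub>R q \<in> affine hull P \<inter> {x. a \<bullet> x = b}"
      using G[OF p(1) q(1)] by (auto intro: hull_inc)
    then have "affine hull P \<inter> {x. a \<bullet> x = b} \<noteq> {}" by blast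
    moreover have "\<not> affine hull P \<subseteq> {x. a \<bullet> x = b}"
      using p hull_inc[of p P affine] by auto
    ultimately show ?thesis by (simp add: aff_dim_affine_Int_hyperplane)
  qed
  finally show ?thesis using ge by simp
qed

lemma maximal_cells_eq_pair:
  assumes "A \<in> \<C>" "B \<in> \<C>" "\<not> A \<subseteq> B" "\<not> B \<subseteq> A"
    and "\<And>C. C \<in> \<C> \<Longrightarrow> C \<subseteq> A \<or> C \<subseteq> B"
  shows "maximal_cells \<C> = {A, B}"
proof (intro set_eqI iffI)
  fix D assume "D \<in> maximal_cells \<C>"
  then have "D \<in> \<C>" "D \<subseteq> A \<Longrightarrow> D = A" "D \<subseteq> B \<Longrightarrow> D = B"
    using assms(1,2) by (simp_all add: maximal_cells_def)
  then show "D \<in> {A, B}" using assms(5)[of D] by auto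
next
  fix D assume "D \<in> {A, B}"
  moreover have "A = C" if "C \<in> \<C>" "A \<subseteq> C" for C
    using assms(5)[OF that(1)] that(2) assms(3) by auto
  moreover have "B = C" if "C \<in> \<C>" "B \<subseteq> C" for C
    using assms(5)[OF that(1)] that(2) assms(4) by auto
  ultimately show "D \<in> maximal_cells \<C>"
    using assms(1,2) by (auto simp: maximal_cells_def)
qed

text \<open>
The cells are all faces of the two halves. Their common part is a face of both, so a face of one half
meets a face of the other in a face of the common part; by transitivity of faces this is a face of
each.
\<close>

lemma split_alongI:
  fixes V :: "'a::euclidean_space set"
  defines "P \<equiv> convex hull V"
  assumes fin: "finite V"
    and ext: "\<And>v. v \<in> V \<Longrightarrow> v extreme_point_of P"
    and H: "P \<inter> {x. a \<bullet> x = b} \<subseteq> convex hull (V \<inter> {x. a \<bullet> x = b})"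
    and p: "p \<in> P" "b < a \<bullet> p" and q: "q \<in> P" "a \<bullet> q < b"
  shows "split_along P a b (P \<inter> {x. a \<bullet> x \<ge> b}) (P \<inter> {x. a \<bullet> x \<le> b})"
proof -
  let ?F1 = "P \<inter> {x. a \<bullet> x \<ge> b}" and ?F2 = "P \<inter> {x. a \<bullet> x \<le> b}"
  let ?G = "P \<inter> {x. a \<bullet> x = b}"
  have F1: "?F1 = convex hull (V \<inter> {x. a \<bullet> x \<ge> b})"
    unfolding P_def using H by (intro convex_hull_Int_halfspace_ge) (simp add: P_def)
  have F2: "?F2 = convex hull (V \<inter> {x. a \<bullet> x \<le> b})"
    unfolding P_def using H by (intro convex_hull_Int_halfspace_le) (simp add: P_def)
  have poly: "polytope ?F1" "polytope ?F2"
    unfolding F1 F2 using fin by (auto simp: polytope_convex_hull)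
  have G: "?F1 \<inter> ?F2 = ?G" by auto
  have "?F1 \<inter> {x. a \<bullet> x = b} face_of ?F1"
    by (rule face_of_Int_supporting_hyperplane_ge) (auto simp: polytope_imp_convex[OF poly(1)])
  moreover have "?F1 \<inter> {x. a \<bullet> x = b} = ?G" by auto
  ultimately have GF1: "?G face_of ?F1" by simp
  have "?F2 \<inter> {x. a \<bullet> x = b} face_of ?F2"
    by (rule face_of_Int_supporting_hyperplane_le) (auto simp: polytope_imp_convex[OF poly(2)])
  moreover have "?F2 \<inter> {x. a \<bullet> x = b} = ?G" by auto
  ultimately have GF2: "?G face_of ?F2" by simp
  define \<C> where "\<C> = {C. C face_of ?F1} \<union> {C. C face_of ?F2}"
  have self: "?F1 face_of ?F1" "?F2 face_of ?F2"
    by (simp_all add: face_of_refl polytope_imp_convex poly)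
  have cross: "(C \<inter> D) face_of C \<and> (C \<inter> D) face_of D"
    if C: "C face_of A" and D: "D face_of B" and AB: "A \<inter> B = ?G"
      and GA: "?G face_of A" and GB: "?G face_of B"
    for A B C D :: "'a set"
  proof -
    have CD: "C \<inter> D \<subseteq> ?G"
      using face_of_imp_subset[OF C] face_of_imp_subset[OF D] unfolding AB[symmetric] by blast
    have "D \<inter> ?G face_of ?G"
      using face_of_Int[OF D GB] unfolding face_of_face[OF GB] by blast
    then have "D \<inter> ?G face_of A" using GA by (rule face_of_trans)
    with C have "C \<inter> (D \<inter> ?G) face_of A" by (rule face_of_Int)
    moreover have "C \<inter> ?G face_of ?G"
      using face_of_Int[OF C GA] unfolding face_of_face[OF GA] by blast
    then have "C \<inter> ?G face_of B" using GB by (rule face_of_trans)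
    with D have "D \<inter> (C \<inter> ?G) face_of B" by (rule face_of_Int)
    moreover have "C \<inter> (D \<inter> ?G) = C \<inter> D" "D \<inter> (C \<inter> ?G) = C \<inter> D" using CD by auto
    ultimately show ?thesis using C D by (simp add: face_of_face)
  qed
  have same: "(C \<inter> D) face_of C \<and> (C \<inter> D) face_of D" if "C face_of A" "D face_of A"
    for A C D :: "'a set"
    using face_of_Int[OF that] that by (simp add: face_of_face)
  have "polytopal_subdivision \<C> P"
    unfolding polytopal_subdivision_def
  proof (intro conjI ballI allI impI)
    show "finite \<C>" using poly by (simp add: \<C>_def finite_polytope_faces)
    show "polytope C" if "C \<in> \<C>" for C
      using that poly by (auto simp: \<C>_def intro: face_of_polytope_polytope)
    show "F \<in> \<C>" if "C \<in> \<C>" "F face_of C" for C F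
      using that by (auto simp: \<C>_def intro: face_of_trans)
    have "(C \<inter> D) face_of C \<and> (C \<inter> D) face_of D" if CD: "C \<in> \<C>" "D \<in> \<C>" for C D
    proof -
      have G': "?F2 \<inter> ?F1 = ?G" using G by blast
      consider "C face_of ?F1" "D face_of ?F1" | "C face_of ?F1" "D face_of ?F2"
        | "C face_of ?F2" "D face_of ?F1" | "C face_of ?F2" "D face_of ?F2"
        using CD unfolding \<C>_def by blast
      then show ?thesis
      proof cases
        case 1 then show ?thesis by (rule same)
      next
        case 2 then show ?thesis by (rule cross[OF _ _ G GF1 GF2])
      next
        case 3 then show ?thesis by (rule cross[OF _ _ G' GF2 GF1])
      next
        case 4 then show ?thesis by (rule same)
      qed
    qed
    then show "(C \<inter> D) face_of C" "(C \<inter> D) face_of D" if "C \<in> \<C>" "D \<in> \<C>" for C D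
      using that by (simp_all only:)
    show "\<Union>\<C> = P"
    proof
      show "\<Union>\<C> \<subseteq> P" by (auto simp: \<C>_def dest!: face_of_imp_subset)
      have "?F1 \<in> \<C>" "?F2 \<in> \<C>" using self by (auto simp: \<C>_def)
      moreover have "P \<subseteq> ?F1 \<union> ?F2" by auto
      ultimately show "P \<subseteq> \<Union>\<C>" by blast
    qed
  qed
  moreover have "\<forall>C\<in>\<C>. \<forall>x. x extreme_point_of C \<longrightarrow> x extreme_point_of P"
  proof (intro ballI allI impI)
    fix C x assume C: "C \<in> \<C>" and x: "x extreme_point_of C"
    have "x extreme_point_of ?F1 \<or> x extreme_point_of ?F2"
      using C x unfolding \<C>_def by (auto simp: extreme_point_of_face)
    then have "x \<in> V" unfolding F1 F2 by (auto dest!: extreme_point_of_convex_hull)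
    then show "x extreme_point_of P" by (rule ext)
  qed
  moreover have incomparable: "\<not> ?F1 \<subseteq> ?F2" "\<not> ?F2 \<subseteq> ?F1" using p q by auto
  then have "?F1 \<noteq> ?F2" by blast
  moreover have "maximal_cells \<C> = {?F1, ?F2}"
  proof (rule maximal_cells_eq_pair[OF _ _ incomparable])
    show "C \<subseteq> ?F1 \<or> C \<subseteq> ?F2" if "C \<in> \<C>" for C
      using that face_of_imp_subset[of C ?F1] face_of_imp_subset[of C ?F2] unfolding \<C>_def by blast
  qed (use self in \<open>simp_all add: \<C>_def\<close>)
  moreover have "?F1 \<inter> ?F2 \<in> \<C>" using GF1 unfolding G by (simp add: \<C>_def)
  moreover have "aff_dim (?F1 \<inter> ?F2) = aff_dim P - 1"
    unfolding G by (rule aff_dim_Int_crossing_hyperplane[OF _ p q]) (simp add: P_def)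
  moreover have "a \<noteq> 0" using p q by auto
  moreover have "?F1 \<inter> ?F2 \<subseteq> {x. a \<bullet> x = b}" unfolding G by blast
  ultimately show ?thesis
    unfolding split_along_def by (intro conjI exI[of _ \<C>] refl)
qed

section \<open>Slices of the permutahedron\<close>

abbreviation coord_at :: "nat \<Rightarrow> 'n::{finite,linorder}" where
  "coord_at \<equiv> inv_into UNIV coord_index"

lemma coord_at_coord_index [simp]: "coord_at (coord_index i) = i"
  by (rule inv_f_f[OF strict_mono_imp_inj_on[OF coord_index_strict_mono]])

lemma sum_coord_index:
  "(\<Sum>i\<in>UNIV. g (coord_index (i::'n::{finite,linorder}))) = (\<Sum>k\<in>{1..CARD('n)}. g k)"
  by (rule sum.reindex_bij_betw[OF coord_index_bij])

lemma inner_perm_point: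
  fixes c :: "real ^ 'n::{finite,linorder}"
  shows "c \<bullet> perm_point z = (\<Sum>k\<in>{1..CARD('n)}. c $ coord_at k * real (z k))"
  unfolding inner_vec_def perm_point_def
  using sum_coord_index[where 'n = 'n, of "\<lambda>k. c $ coord_at k * real (z k)"] by simp

lemma inner_indicator_point:
  fixes c :: "real ^ 'n::{finite,linorder}"
  assumes "B \<subseteq> {1..CARD('n)}"
  shows "c \<bullet> indicator_point B = (\<Sum>k\<in>B. c $ coord_at k)"
proof -
  have "c \<bullet> indicator_point B = (\<Sum>k\<in>{1..CARD('n)}. if k \<in> B then c $ coord_at k else 0)"
    unfolding inner_vec_def indicator_point_def
    using sum_coord_index[where 'n = 'n, of "\<lambda>k. if k \<in> B then c $ coord_at k else 0"]
    by (simp add: if_distrib[of "\<lambda>x. _ * x"] cong: if_cong)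
  also have "\<dots> = (\<Sum>k\<in>B. c $ coord_at k)"
    using assms by (simp flip: sum.inter_restrict add: Int_absorb1)
  finally show ?thesis .
qed

lemma indicator_point_coord_at:
  "k \<in> {1..CARD('n)} \<Longrightarrow>
   (indicator_point A :: real ^ 'n::{finite,linorder}) $ coord_at k = of_bool (k \<in> A)"
proof -
  assume "k \<in> {1..CARD('n)}"
  then have "coord_index (coord_at k :: 'n) = k"
    using coord_index_bij[where 'n = 'n] by (metis bij_betw_inv_into_right)
  then show ?thesis by (simp add: indicator_point_def)
qed

text \<open>
All permutations have the same norm, so their points lie on a sphere that encloses the permutahedron.
\<close>

lemma extreme_point_permutahedron:
  assumes z: "z permutes {1..CARD('n)}"
  shows "(perm_point z :: real ^ 'n::{finite,linorder}) extreme_point_of permutahedron"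
proof -
  let ?n = "CARD('n)"
  let ?R = "sqrt (\<Sum>v\<in>{1..?n}. (real v)\<^sup>2)"
  have norm: "norm (perm_point y :: (real, 'n) vec) = ?R" if y: "y permutes {1..?n}" for y
  proof -
    have "norm (perm_point y :: (real, 'n) vec) = sqrt (\<Sum>k\<in>{1..?n}. (real (y k))\<^sup>2)"
      using sum_coord_index[where 'n = 'n, of "\<lambda>k. (real (y k))\<^sup>2"]
      by (simp add: norm_vec_def L2_set_def perm_point_def)
    also have "(\<Sum>k\<in>{1..?n}. (real (y k))\<^sup>2) = (\<Sum>v\<in>{1..?n}. (real v)\<^sup>2)"
      using sum.reindex_bij_betw[OF permutes_imp_bij[OF y], of "\<lambda>v. (real v)\<^sup>2"] .
    finally show ?thesis .
  qed
  have "(permutahedron :: ((real, 'n) vec) set) \<subseteq> cball 0 ?R"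
    unfolding permutahedron_def by (intro hull_minimal convex_cball) (auto simp: norm)
  then have le: "norm x \<le> ?R" if "x \<in> permutahedron" for x :: "(real, 'n) vec"
    using that by auto
  have "perm_point z \<notin> open_segment x y" if "x \<in> permutahedron" "y \<in> permutahedron"
    for x y :: "(real, 'n) vec"
    using dist_decreases_open_segment[of "perm_point z" x y 0] le[OF that(1)] le[OF that(2)] norm[OF z]
    by auto
  then show ?thesis
    using z by (auto simp: extreme_point_of_def permutahedron_def intro!: hull_inc)
qed

text \<open>
A functional \<open>c\<close> separating a point \<open>x\<close> of the slice from the permutations of the slice is
impossible: \<open>c\<close> may be changed by a multiple of \<open>a\<close>, which is constant on the slice, such that a
permutation of the slice becomes extremal on the whole permutahedron.
\<close>

lemma permutahedron_slice:
  fixes a :: "real ^ 'n::{finite,linorder}" and b :: nat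
  assumes a_def: "a = indicator_point A"
    and lo: "zlo permutes {1..CARD('n)}" "a \<bullet> perm_point zlo < b"
    and hi: "zhi permutes {1..CARD('n)}" "a \<bullet> perm_point zhi > b"
  shows "permutahedron \<inter> {x. a \<bullet> x = b}
    \<subseteq> convex hull (perm_point ` {z. z permutes {1..CARD('n)}} \<inter> {x. a \<bullet> x = b})"
    (is "_ \<subseteq> convex hull ?V")
proof
  let ?n = "CARD('n)"
  have a: "a \<bullet> perm_point z = (\<Sum>k\<in>{1..?n}. of_bool (k \<in> A) * real (z k))" for z
    unfolding inner_perm_point by (intro sum.cong) (auto simp: a_def indicator_point_coord_at)
  fix x :: "(real, 'n) vec" assume "x \<in> permutahedron \<inter> {x. a \<bullet> x = b}"
  then have x: "x \<in> permutahedron" "a \<bullet> x = b" by auto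
  show "x \<in> convex hull ?V"
  proof (rule ccontr)
    assume "x \<notin> convex hull ?V"
    moreover have "closed (convex hull ?V)"
      by (intro compact_imp_closed finite_imp_compact_convex_hull finite_Int disjI1 finite_imageI
          finite_permutations) simp
    ultimately obtain c d where c: "c \<bullet> x < d" "\<forall>y\<in>convex hull ?V. c \<bullet> y > d"
      using separating_hyperplane_closed_point[of "convex hull ?V" x] by auto
    let ?P = "{z. z permutes {1..?n}}" and ?w = "\<lambda>t k. (- c) $ coord_at k + t * of_bool (k \<in> A)"
    have lo': "zlo \<in> ?P" "(\<Sum>k\<in>{1..?n}. of_bool (k \<in> A) * real (zlo k)) < b"
      and hi': "zhi \<in> ?P" "(\<Sum>k\<in>{1..?n}. of_bool (k \<in> A) * real (zhi k)) > b"
      using lo hi unfolding a by blast+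
    obtain z t where zP: "z \<in> ?P" and zb: "(\<Sum>k\<in>{1..?n}. of_bool (k \<in> A) * real (z k)) = b"
      and opt: "\<forall>z'\<in>?P.
        (\<Sum>k\<in>{1..?n}. ?w t k * real (z' k)) \<le> (\<Sum>k\<in>{1..?n}. ?w t k * real (z k))"
      by (rule exists_level_maximiser[OF lo' hi', where c = "\<lambda>k. (- c) $ coord_at k"])
        (rule that, assumption+)
    have z: "z permutes {1..?n}" "a \<bullet> perm_point z = b"
      using zP zb unfolding a by blast+
    have val: "(- c + t *\<^sub>R a) \<bullet> perm_point z'
        = (\<Sum>k\<in>{1..?n}. ((- c) $ coord_at k + t * of_bool (k \<in> A)) * real (z' k))" for z'
      unfolding inner_perm_point by (intro sum.cong) (auto simp: a_def indicator_point_coord_at)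
    have "permutahedron \<subseteq> {y. (- c + t *\<^sub>R a) \<bullet> y \<le> (- c + t *\<^sub>R a) \<bullet> perm_point z}"
      unfolding permutahedron_def
      by (intro hull_minimal convex_halfspace_le image_subsetI) (use opt in \<open>simp only: val mem_Collect_eq\<close>)
    then have "(- c + t *\<^sub>R a) \<bullet> x \<le> (- c + t *\<^sub>R a) \<bullet> perm_point z" using x by auto
    then have "c \<bullet> perm_point z \<le> c \<bullet> x"
      using x z by (simp add: inner_add_left inner_diff_left)
    moreover have "perm_point z \<in> convex hull ?V" using z by (intro hull_inc) auto
    ultimately show False using c by force
  qed
qed

section \<open>Bruhat order\<close>

text \<open>
The inversions of \<open>z\<close> are mapped injectively to those of the transposed permutation. The positions
of an inversion are transposed as long as this preserves their order; otherwise one of them is \<open>a\<close>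
or \<open>b\<close>, the other lies strictly between, and the same pair is still an inversion. The new inversion
\<open>(a, b)\<close> is not hit.
\<close>

lemma perm_length_transpose_less:
  assumes z: "z permutes {1..n}" and ab: "1 \<le> a" "a < b" "b \<le> n" and lt: "z a < z b"
  shows "perm_length n z < perm_length n (z \<circ> Transposition.transpose a b)"
proof -
  let ?t = "Transposition.transpose a b"
  let ?inv = "\<lambda>z. {(i, j). i \<in> {1..n} \<and> j \<in> {1..n} \<and> i < j \<and> z j < (z i :: nat)}"
  let ?f = "\<lambda>(i, j). if ?t i < ?t j then (?t i, ?t j) else (i, j)"
  have fin: "finite (?inv y)" for y
    by (rule finite_subset[of _ "{1..n} \<times> {1..n}"]) auto
  have mem: "?t i \<in> {1..n} \<longleftrightarrow> i \<in> {1..n}" for i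
    using ab by (auto simp: Transposition.transpose_def)
  have inj: "inj_on ?f (?inv z)"
  proof (rule inj_onI)
    fix p q assume pq: "p \<in> ?inv z" "q \<in> ?inv z" and eq: "?f p = ?f q"
    obtain i j k l where p: "p = (i, j)" and q: "q = (k, l)" by (metis surj_pair)
    have "i < j" "k < l" using pq by (simp_all add: p q)
    then show "p = q"
      using eq by (auto simp: p q transpose_eq_iff split: if_splits)
  qed
  have "?f ` ?inv z \<subseteq> ?inv (z \<circ> ?t) - {(a, b)}"
  proof (rule image_subsetI)
    fix p assume "p \<in> ?inv z"
    then obtain i j where p: "p = (i, j)" and ij: "i \<in> {1..n}" "j \<in> {1..n}" "i < j" "z j < z i"
      by auto
    show "?f p \<in> ?inv (z \<circ> ?t) - {(a, b)}"
    proof (cases "?t i < ?t j")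
      case True
      moreover have "(?t i, ?t j) \<noteq> (a, b)"
      proof
        assume "(?t i, ?t j) = (a, b)"
        then have "i = b" "j = a" by (auto simp: transpose_eq_iff)
        then show False using ij(3) ab by simp
      qed
      ultimately show ?thesis using ij mem[of i] mem[of j] by (simp add: p)
    next
      case False
      then have "i = a \<and> j < b \<or> j = b \<and> a < i \<or> i = a \<and> j = b"
        using ij(3) ab by (auto simp: Transposition.transpose_def split: if_splits)
      then have "z (?t j) < z (?t i) \<and> (i, j) \<noteq> (a, b)"
        using ij lt by (auto simp: Transposition.transpose_def)
      then show ?thesis using False ij by (simp add: p)
    qed
  qed
  then have "card (?inv z) \<le> card (?inv (z \<circ> ?t) - {(a, b)})"
    using inj fin by (intro card_inj_on_le[of ?f]) auto
  also have "\<dots> < card (?inv (z \<circ> ?t))"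
    using fin ab lt by (intro card_Diff1_less) auto
  finally show ?thesis by (simp add: perm_length_def)
qed

text \<open>
A description of Bruhat steps by values instead of lengths; from here on lengths serve only as a
measure for termination.
\<close>

lemma bruhat_step_iff:
  assumes u: "u permutes {1..n}"
  shows "bruhat_step n u v \<longleftrightarrow>
    (\<exists>a b. 1 \<le> a \<and> a < b \<and> b \<le> n \<and> u a < u b \<and> v = u \<circ> Transposition.transpose a b)"
proof
  assume "bruhat_step n u v"
  then obtain a b where ab: "a \<in> {1..n}" "b \<in> {1..n}" "a < b"
    and v: "v = u \<circ> Transposition.transpose a b" and len: "perm_length n u < perm_length n v"
    unfolding bruhat_step_def by (metis nat_neq_iff transpose_commute)
  have "u a < u b"
  proof (rule ccontr)
    assume "\<not> u a < u b"
    moreover have "u a \<noteq> u b" using permutes_inj[OF u] ab(3) by (auto dest: injD)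
    ultimately have "v a < v b" by (simp add: v)
    moreover have "v permutes {1..n}" unfolding v by (rule permutes_comp_transpose[OF u ab(1,2)])
    ultimately have "perm_length n v < perm_length n (v \<circ> Transposition.transpose a b)"
      using ab by (intro perm_length_transpose_less) auto
    also have "v \<circ> Transposition.transpose a b = u" by (simp add: v o_assoc[symmetric])
    finally show False using len by simp
  qed
  then show "\<exists>a b. 1 \<le> a \<and> a < b \<and> b \<le> n \<and> u a < u b \<and> v = u \<circ> Transposition.transpose a b"
    using ab v by auto
next
  assume "\<exists>a b. 1 \<le> a \<and> a < b \<and> b \<le> n \<and> u a < u b \<and> v = u \<circ> Transposition.transpose a b"
  then obtain a b where "1 \<le> a" "a < b" "b \<le> n" "u a < u b" "v = u \<circ> Transposition.transpose a b"
    by blast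
  then show "bruhat_step n u v"
    unfolding bruhat_step_def using perm_length_transpose_less[OF u, of a b]
    by (intro bexI[of _ a] bexI[of _ b]) auto
qed

lemma bruhat_step_permutes:
  assumes "u permutes {1..n}" "bruhat_step n u v"
  shows "v permutes {1..n}"
  using assms permutes_comp_transpose[OF assms(1)] unfolding bruhat_step_def by blast

lemma bruhat_le_refl: "u permutes {1..n} \<Longrightarrow> bruhat_le n u u"
  by (simp add: bruhat_le_def)

text \<open>
A Bruhat step moves a larger value to the left. With \<open>g\<close> the identity this says that prefix sums
increase; with \<open>g\<close> the indicator function of the large values it says that the number of top
positions in a prefix increases.
\<close>

lemma bruhat_prefix_sum_mono:
  fixes g :: "nat \<Rightarrow> nat"
  assumes uv: "bruhat_le n u v" and g: "mono g"
  shows "(\<Sum>i\<in>{1..j}. g (u i)) \<le> (\<Sum>i\<in>{1..j}. g (v i))"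
proof -
  have "(bruhat_step n)\<^sup>*\<^sup>* u v" "u permutes {1..n}" using uv by (auto simp: bruhat_le_def)
  then have "v permutes {1..n} \<and> (\<Sum>i\<in>{1..j}. g (u i)) \<le> (\<Sum>i\<in>{1..j}. g (v i))"
  proof (induction rule: rtranclp_induct)
    case base
    then show ?case by simp
  next
    case (step y z)
    then have y: "y permutes {1..n}" by simp
    obtain a b where ab: "1 \<le> a" "a < b" "b \<le> n" "y a < y b"
      and z: "z = y \<circ> Transposition.transpose a b"
      using step.hyps(2) unfolding bruhat_step_iff[OF y] by blast
    have "(\<Sum>i\<in>{1..j}. g (y i)) \<le> (\<Sum>i\<in>{1..j}. g (z i))"
    proof (cases "b \<le> j")
      case True
      then have "Transposition.transpose a b permutes {1..j}"
        using ab by (intro permutes_swap_id) auto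
      from sum.permute[OF this, of "\<lambda>i. g (y i)"] show ?thesis by (simp add: z)
    next
      case False
      then show ?thesis
        using ab monoD[OF g, of "y a" "y b"] by (intro sum_mono) (auto simp: z Transposition.transpose_def)
    qed
    then show ?case using step bruhat_step_permutes[OF y step.hyps(2)] by auto
  qed
  then show ?thesis by simp
qed

lemma strictly_increasing_eq:
  fixes f g :: "nat \<Rightarrow> nat"
  assumes "finite S" and f: "\<And>a b. a \<in> S \<Longrightarrow> b \<in> S \<Longrightarrow> a < b \<Longrightarrow> f a < f b"
    and g: "\<And>a b. a \<in> S \<Longrightarrow> b \<in> S \<Longrightarrow> a < b \<Longrightarrow> g a < g b"
    and "f ` S = g ` S" and "x \<in> S"
  shows "f x = g x"
proof -
  let ?xs = "sorted_list_of_set S"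
  have strict: "sorted_wrt (<) (map h ?xs)"
    if "\<And>a b. a \<in> S \<Longrightarrow> b \<in> S \<Longrightarrow> a < b \<Longrightarrow> h a < h b" for h :: "nat \<Rightarrow> nat"
    unfolding sorted_wrt_map
    by (rule sorted_wrt_mono_rel[OF _ strict_sorted_list_of_set]) (use that assms(1) in auto)
  have "map f ?xs = map g ?xs"
    using strict[of f] strict[of g] f g assms(1,4)
    by (intro sorted_distinct_set_unique) (auto simp: strict_sorted_iff)
  then show ?thesis using assms by simp
qed

lemma down_closed_eq_atLeastAtMost:
  fixes X :: "nat set"
  assumes "finite X" "0 \<notin> X" and down: "\<And>v. Suc v \<in> X \<Longrightarrow> 0 < v \<Longrightarrow> v \<in> X"
  shows "X = {1..card X}"
proof (cases "X = {}")
  case False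
  define m where "m = Max X"
  have m: "m \<in> X" using assms False by (simp add: m_def)
  have "v \<in> X" if "v \<le> m" "0 < v" for v
    using that
  proof (induction rule: inc_induct)
    case base
    show ?case by (rule m)
  next
    case (step k)
    then show ?case using down by simp
  qed
  moreover have "v \<le> m" if "v \<in> X" for v using that assms by (simp add: m_def)
  ultimately have "X = {1..m}"
    using assms(2) by (auto simp: Suc_le_eq) (metis neq0_conv)
  then show ?thesis by simp
qed simp

text \<open>
The longest permutation, extended by the identity outside \<open>{1..n}\<close>. Composition with it from the
left complements values and reverses the Bruhat order.
\<close>

definition rev_perm :: "nat \<Rightarrow> nat \<Rightarrow> nat" where
  "rev_perm n k = (if k \<in> {1..n} then n + 1 - k else k)"

lemma rev_perm_rev_perm [simp]: "rev_perm n (rev_perm n k) = k"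
  by (auto simp: rev_perm_def)

lemma rev_perm_comp_rev_perm [simp]: "rev_perm n \<circ> (rev_perm n \<circ> z) = z"
  by (simp add: fun_eq_iff)

lemma rev_perm_permutes: "rev_perm n permutes {1..n}"
  by (rule bij_imp_permutes[OF bij_betwI[where g = "rev_perm n"]]) (auto simp: rev_perm_def)

lemma rev_perm_image_prefix:
  assumes j: "j \<le> n"
  shows "rev_perm n ` {1..j} = {n - j + 1..n}"
proof (intro equalityI subsetI)
  fix v assume "v \<in> {n - j + 1..n}"
  then have "v = rev_perm n (n + 1 - v)" "n + 1 - v \<in> {1..j}" using j by (auto simp: rev_perm_def)
  then show "v \<in> rev_perm n ` {1..j}" by blast
qed (use j in \<open>auto simp: rev_perm_def\<close>)

lemma sum_rev_perm:
  assumes "B \<subseteq> {1..n}"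
  shows "\<Sum>B + \<Sum>(rev_perm n ` B) = card B * (n + 1)"
proof -
  have "\<Sum>(rev_perm n ` B) = (\<Sum>k\<in>B. rev_perm n k)"
    by (simp add: sum.reindex inj_on_subset[OF permutes_inj[OF rev_perm_permutes]])
  then have "\<Sum>B + \<Sum>(rev_perm n ` B) = (\<Sum>k\<in>B. k + rev_perm n k)"
    by (simp add: sum.distrib)
  also have "\<dots> = (\<Sum>k\<in>B. n + 1)"
    using assms by (intro sum.cong) (auto simp: rev_perm_def)
  finally show ?thesis by simp
qed

lemma prefix_sum_eq_sum_image:
  assumes "z permutes S"
  shows "(\<Sum>i\<in>{1..j}. z i) = \<Sum>(z ` {1..j})"
  by (simp add: sum.reindex inj_on_subset[OF permutes_inj[OF assms]])

lemma card_permutes_image: "z permutes S \<Longrightarrow> card (z ` B) = card B"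
  by (simp add: card_image inj_on_subset[OF permutes_inj])

lemma bruhat_le_rev_perm:
  assumes "bruhat_le n u v"
  shows "bruhat_le n (rev_perm n \<circ> v) (rev_perm n \<circ> u)"
proof -
  have "(bruhat_step n)\<^sup>*\<^sup>* u v" "u permutes {1..n}" using assms by (auto simp: bruhat_le_def)
  then have "v permutes {1..n} \<and> (bruhat_step n)\<^sup>*\<^sup>* (rev_perm n \<circ> v) (rev_perm n \<circ> u)"
  proof (induction rule: rtranclp_induct)
    case base
    then show ?case by simp
  next
    case (step y z)
    then have y: "y permutes {1..n}" by simp
    obtain a b where ab: "1 \<le> a" "a < b" "b \<le> n" "y a < y b"
      and z: "z = y \<circ> Transposition.transpose a b"
      using step.hyps(2) unfolding bruhat_step_iff[OF y] by blast
    have z_perm: "z permutes {1..n}" by (rule bruhat_step_permutes[OF y step.hyps(2)])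
    have "y a \<in> {1..n}" "y b \<in> {1..n}" 
      using ab permutes_in_image[OF y, of a] permutes_in_image[OF y, of b] by simp_all
    then have "(rev_perm n \<circ> z) a < (rev_perm n \<circ> z) b"
      using ab by (auto simp: z rev_perm_def)
    moreover have "rev_perm n \<circ> y = (rev_perm n \<circ> z) \<circ> Transposition.transpose a b"
      by (simp add: z fun_eq_iff)
    ultimately have "bruhat_step n (rev_perm n \<circ> z) (rev_perm n \<circ> y)"
      unfolding bruhat_step_iff[OF permutes_compose[OF z_perm rev_perm_permutes]] using ab by blast
    from converse_rtranclp_into_rtranclp[where r = "bruhat_step n", OF this] show ?case
      using step.IH[OF step.prems] z_perm by (simp only:)
  qed
  then show ?thesis
    using assms permutes_compose[OF _ rev_perm_permutes] unfolding bruhat_le_def by blast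
qed

text \<open>
The set \<open>S\<close> of permutations whose prefix sum is at least \<open>\<Sum>A\<close> has a least element. Descending by
transpositions that stay in \<open>S\<close> ends in a local minimum, and there is only one. Indeed, sorting
within the blocks \<open>{1..j}\<close> and \<open>{j+1..n}\<close> never leaves \<open>S\<close>, so a local minimum increases on
both. If its prefix sum were larger than \<open>\<Sum>A\<close>, then its prefix values would not be \<open>{1..j}\<close>, so some
value \<open>v + 1\<close> would be in the prefix while \<open>v\<close> is not, and exchanging them would lower the prefix sum
by just one. Hence its prefix values have sum \<open>\<Sum>A\<close>, so they are \<open>A\<close> by uniqueness, and
the permutation is determined.
\<close>

lemma ex_bruhat_least_of_unique_prefix:
  assumes A: "A \<subseteq> {1..n}"
    and uniq: "\<And>B. B \<subseteq> {1..n} \<Longrightarrow> card B = card A \<Longrightarrow> \<Sum>B = \<Sum>A \<Longrightarrow> B = A"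
  shows "\<exists>u. u permutes {1..n} \<and> u ` {1..card A} = A \<and>
    (\<forall>z. z permutes {1..n} \<longrightarrow> \<Sum>A \<le> (\<Sum>i\<in>{1..card A}. z i) \<longrightarrow> bruhat_le n u z)"
proof -
  define j where "j = card A"
  have j: "j \<le> n" using card_mono[OF _ A] by (simp add: j_def)
  have finA: "finite A" using A finite_subset by blast
  define S where "S = {z. z permutes {1..n} \<and> \<Sum>A \<le> (\<Sum>i\<in>{1..j}. z i)}"
  define locmin where "locmin z \<longleftrightarrow> z \<in> S \<and>
    (\<forall>a b. 1 \<le> a \<and> a < b \<and> b \<le> n \<and> z b < z a \<longrightarrow> z \<circ> Transposition.transpose a b \<notin> S)" for z
  have below: "\<exists>y. locmin y \<and> bruhat_le n y z" if "z \<in> S" for z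
    using that
  proof (induction "perm_length n z" arbitrary: z rule: less_induct)
    case less
    have z: "z permutes {1..n}" using less.prems by (simp add: S_def)
    show ?case
    proof (cases "locmin z")
      case True
      then show ?thesis using bruhat_le_refl[OF z] by blast
    next
      case False
      then obtain a b where ab: "1 \<le> a" "a < b" "b \<le> n" "z b < z a"
        and yS: "z \<circ> Transposition.transpose a b \<in> S"
        using less.prems unfolding locmin_def by blast
      define y where "y = z \<circ> Transposition.transpose a b"
      have y: "y permutes {1..n}" using yS by (simp add: S_def y_def)
      have zy: "z = y \<circ> Transposition.transpose a b" by (simp add: y_def o_assoc[symmetric])
      have lt: "y a < y b" using ab by (simp add: y_def)
      have "perm_length n y < perm_length n z"
        using perm_length_transpose_less[OF y ab(1-3) lt] unfolding zy[symmetric] .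
      then obtain x where x: "locmin x" "bruhat_le n x y" using less.hyps yS unfolding y_def by blast
      have "bruhat_step n y z" unfolding bruhat_step_iff[OF y] using ab lt zy by blast
      then have "bruhat_le n x z"
        using x(2) z unfolding bruhat_le_def by (blast intro: rtranclp.rtrancl_into_rtrancl)
      then show ?thesis using x by blast
    qed
  qed
  have same_block: "z a < z b"
    if z: "locmin z" and ab: "1 \<le> a" "a < b" "b \<le> n" "b \<le> j \<or> j < a" for z a b
  proof (rule ccontr)
    assume "\<not> z a < z b"
    have zp: "z permutes {1..n}" and zs: "\<Sum>A \<le> (\<Sum>i\<in>{1..j}. z i)"
      using z by (auto simp: locmin_def S_def)
    have "z a \<noteq> z b" using permutes_inj[OF zp] ab by (auto dest: injD)
    with \<open>\<not> z a < z b\<close> have "z b < z a" by simp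
    have "(\<Sum>i\<in>{1..j}. (z \<circ> Transposition.transpose a b) i) = (\<Sum>i\<in>{1..j}. z i)"
    proof (cases "b \<le> j")
      case True
      then have "Transposition.transpose a b permutes {1..j}"
        using ab by (intro permutes_swap_id) auto
      from sum.permute[OF this, of z] show ?thesis by simp
    next
      case False
      then show ?thesis using ab by (intro sum.cong) (auto simp: Transposition.transpose_def)
    qed
    then have "z \<circ> Transposition.transpose a b \<in> S"
      using zs permutes_comp_transpose[OF zp, of a b] ab by (simp add: S_def)
    then show False using z ab \<open>z b < z a\<close> by (auto simp: locmin_def)
  qed
  have prefix: "z ` {1..j} = A" if z: "locmin z" for z
  proof -
    have zp: "z permutes {1..n}" and zs: "\<Sum>A \<le> (\<Sum>i\<in>{1..j}. z i)"
      using z by (auto simp: locmin_def S_def)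
    have sub: "z ` {1..j} \<subseteq> {1..n}" using permutes_image[OF zp] j by (metis atLeastatMost_subset_iff image_mono order_refl)
    have card: "card (z ` {1..j}) = j" using card_permutes_image[OF zp] by simp
    have "(\<Sum>i\<in>{1..j}. z i) = \<Sum>A"
    proof (rule ccontr)
      assume ne: "(\<Sum>i\<in>{1..j}. z i) \<noteq> \<Sum>A"
      have "z ` {1..j} = {1..card (z ` {1..j})}"
      proof (rule down_closed_eq_atLeastAtMost)
        show "0 \<notin> z ` {1..j}" using sub by auto
        fix v assume v: "Suc v \<in> z ` {1..j}" "0 < v"
        show "v \<in> z ` {1..j}"
        proof (rule ccontr)
          assume nv: "v \<notin> z ` {1..j}"
          obtain a where a: "a \<in> {1..j}" "z a = Suc v" using v(1) by auto
          have "v \<in> z ` {1..n}" using v sub permutes_image[OF zp] by auto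
          then obtain b where b: "b \<in> {1..n}" "z b = v" by auto
          have "b > j" using nv b by (force simp: not_le[symmetric])
          define y where "y = z \<circ> Transposition.transpose a b"
          have "(\<Sum>i\<in>{1..j}. z i) = Suc (\<Sum>i\<in>{1..j}. y i)"
          proof -
            have "(\<Sum>i\<in>{1..j} - {a}. y i) = (\<Sum>i\<in>{1..j} - {a}. z i)"
              using \<open>b > j\<close> by (intro sum.cong) (auto simp: y_def Transposition.transpose_def)
            then show ?thesis
              using a b by (simp add: sum.remove[of _ a] y_def)
          qed
          then have "y \<in> S"
            using zs ne permutes_comp_transpose[OF zp, of a b] a b j by (simp add: S_def y_def)
          moreover have "1 \<le> a" "a < b" "b \<le> n" "z b < z a" using a b \<open>b > j\<close> by auto
          ultimately show False using z unfolding locmin_def y_def by blast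
        qed
      qed simp
      then have "(\<Sum>i\<in>{1..j}. z i) = \<Sum>{1..j}" using prefix_sum_eq_sum_image[OF zp] card by simp
      also have "\<dots> \<le> \<Sum>A"
      proof (rule sum_exchange_le)
        show "b \<le> t" if "b \<in> {1..j} - A" "t \<in> A - {1..j}" for b t
          using that A by auto
      qed (simp_all add: finA j_def)
      finally show False using zs ne by simp
    qed
    then show ?thesis
      using uniq[OF sub] card prefix_sum_eq_sum_image[OF zp] by (simp add: j_def)
  qed
  have unique: "y = z" if y: "locmin y" and z: "locmin z" for y z
  proof
    fix x
    have p: "y permutes {1..n}" "z permutes {1..n}" using y z by (auto simp: locmin_def S_def)
    have rest: "x ` {Suc j..n} = {1..n} - A" if "locmin x" for x
    proof -
      have x: "x permutes {1..n}" using that by (auto simp: locmin_def S_def)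
      have "{Suc j..n} = {1..n} - {1..j}" by auto
      then show ?thesis
        using image_set_diff[OF permutes_inj[OF x]] permutes_image[OF x] prefix[OF that] by metis
    qed
    consider "x \<in> {1..j}" | "x \<in> {Suc j..n}" | "x \<notin> {1..n}" using j by fastforce
    then show "y x = z x"
    proof cases
      case 1
      then show ?thesis
        using same_block[OF y] same_block[OF z] j prefix[OF y] prefix[OF z]
        by (intro strictly_increasing_eq[of "{1..j}"]) auto
    next
      case 2
      then show ?thesis
        using same_block[OF y] same_block[OF z] rest[OF y] rest[OF z]
        by (intro strictly_increasing_eq[of "{Suc j..n}"]) auto
    next
      case 3
      then show ?thesis using p permutes_not_in by metis
    qed
  qed
  have "rev_perm n \<in> S"
  proof -
    have "\<Sum>A \<le> \<Sum>{n - j + 1..n}"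
    proof (rule sum_exchange_le)
      show "b \<le> t" if "b \<in> A - {n - j + 1..n}" "t \<in> {n - j + 1..n} - A" for b t
        using that A by auto
    qed (use j in \<open>simp_all add: finA j_def\<close>)
    also have "{n - j + 1..n} = rev_perm n ` {1..j}" by (rule rev_perm_image_prefix[OF j, symmetric])
    finally show ?thesis
      unfolding S_def mem_Collect_eq prefix_sum_eq_sum_image[OF rev_perm_permutes]
      by (intro conjI rev_perm_permutes)
  qed
  then obtain u where u: "locmin u" using below by blast
  show ?thesis
  proof (intro exI conjI allI impI)
    show "u permutes {1..n}" using u by (simp add: locmin_def S_def)
    show "u ` {1..card A} = A" using prefix[OF u] by (simp add: j_def)
    show "bruhat_le n u z" if "z permutes {1..n}" "\<Sum>A \<le> (\<Sum>i\<in>{1..card A}. z i)" for z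
      using below[of z] unique[OF u] that by (auto simp: S_def j_def)
  qed
qed

lemma ex_bruhat_greatest_of_unique_prefix:
  assumes A: "A \<subseteq> {1..n}"
    and uniq: "\<And>B. B \<subseteq> {1..n} \<Longrightarrow> card B = card A \<Longrightarrow> \<Sum>B = \<Sum>A \<Longrightarrow> B = A"
  shows "\<exists>v. v permutes {1..n} \<and> v ` {1..card A} = A \<and>
    (\<forall>z. z permutes {1..n} \<longrightarrow> (\<Sum>i\<in>{1..card A}. z i) \<le> \<Sum>A \<longrightarrow> bruhat_le n z v)"
proof -
  let ?r = "rev_perm n"
  have r_sub: "?r ` B \<subseteq> {1..n}" if "B \<subseteq> {1..n}" for B
    using that by (auto simp: rev_perm_def)
  have card_r: "card (?r ` B) = card B" for B by (rule card_permutes_image[OF rev_perm_permutes])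
  have rr: "?r ` ?r ` B = B" for B by (simp add: image_image)
  have j: "card A \<le> n" using card_mono[OF _ A] by simp
  have uniq': "B = ?r ` A" if "B \<subseteq> {1..n}" "card B = card (?r ` A)" "\<Sum>B = \<Sum>(?r ` A)" for B
  proof -
    have "\<Sum>(?r ` B) = \<Sum>A"
      using sum_rev_perm[OF that(1)] sum_rev_perm[OF A] that(2,3) by (simp add: card_r)
    then have "?r ` B = A" using that by (intro uniq r_sub) (simp_all add: card_r)
    then show ?thesis using rr by metis
  qed
  obtain u where u: "u permutes {1..n}" "u ` {1..card A} = ?r ` A"
    and least: "\<And>z. z permutes {1..n} \<Longrightarrow> \<Sum>(?r ` A) \<le> (\<Sum>i\<in>{1..card A}. z i) \<Longrightarrow> bruhat_le n u z"
    using ex_bruhat_least_of_unique_prefix[OF r_sub[OF A] uniq'] unfolding card_r by blast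
  show ?thesis
  proof (intro exI[of _ "?r \<circ> u"] conjI allI impI)
    show "(?r \<circ> u) permutes {1..n}" by (rule permutes_compose[OF u(1) rev_perm_permutes])
    show "(?r \<circ> u) ` {1..card A} = A" unfolding image_comp[symmetric] u(2) by (rule rr)
    fix z assume z: "z permutes {1..n}" and le: "(\<Sum>i\<in>{1..card A}. z i) \<le> \<Sum>A"
    have sub: "z ` {1..card A} \<subseteq> {1..n}"
      using permutes_image[OF z] j by (metis atLeastatMost_subset_iff image_mono order_refl)
    have rz: "(?r \<circ> z) permutes {1..n}" by (rule permutes_compose[OF z rev_perm_permutes])
    have "\<Sum>(?r ` A) \<le> (\<Sum>i\<in>{1..card A}. (?r \<circ> z) i)"
      using sum_rev_perm[OF sub] sum_rev_perm[OF A] le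
      unfolding prefix_sum_eq_sum_image[OF rz] prefix_sum_eq_sum_image[OF z] image_comp[symmetric]
      by (simp add: card_permutes_image[OF z])
    from bruhat_le_rev_perm[OF least[OF rz this]] show "bruhat_le n z (?r \<circ> u)"
      by (simp only: rev_perm_comp_rev_perm)
  qed
qed

text \<open>
The extrema of the whole group are the case of the empty prefix.
\<close>

lemma ex_bruhat_least: "\<exists>u. \<forall>z. z permutes {1..n} \<longrightarrow> bruhat_le n u z"
  using ex_bruhat_least_of_unique_prefix[of "{}" n] finite_subset[of _ "{1..n}"] by auto

lemma ex_bruhat_greatest: "\<exists>v. \<forall>z. z permutes {1..n} \<longrightarrow> bruhat_le n z v"
  using ex_bruhat_greatest_of_unique_prefix[of "{}" n] finite_subset[of _ "{1..n}"] by auto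

section \<open>Matroids\<close>

text \<open>
Under the bounds below, these are the bases of the truncation to rank \<open>i\<close> of the direct sum of the
free matroid on \<open>X\<close> and the uniform matroid of rank \<open>i - k\<close> on \<open>E - X\<close>.
\<close>

definition bases_meeting :: "'a set \<Rightarrow> 'a set \<Rightarrow> nat \<Rightarrow> nat \<Rightarrow> 'a set set" where
  "bases_meeting E X i k = {B. B \<subseteq> E \<and> card B = i \<and> k \<le> card (B \<inter> X)}"

text \<open>
These inequalities say that some set of size \<open>i\<close> has exactly \<open>k\<close> elements in \<open>X\<close>, so that the
bound \<open>k\<close> is attained.
\<close>

definition meeting_bounds :: "'a set \<Rightarrow> 'a set \<Rightarrow> nat \<Rightarrow> nat \<Rightarrow> bool" where
  "meeting_bounds E X i k \<longleftrightarrow> finite E \<and> X \<subseteq> E \<and> k \<le> card X \<and> k \<le> i \<and> i - k \<le> card (E - X)"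

lemma indep_bases_meeting_iff:
  assumes "meeting_bounds E X i k"
  shows "matroid_indep (bases_meeting E X i k) I \<longleftrightarrow> I \<subseteq> E \<and> card I \<le> i \<and> card (I - X) \<le> i - k"
proof
  have E: "finite E" using assms by (simp add: meeting_bounds_def)
  assume "matroid_indep (bases_meeting E X i k) I"
  then obtain B where B: "I \<subseteq> B" "B \<subseteq> E" "card B = i" "k \<le> card (B \<inter> X)"
    by (auto simp: matroid_indep_def bases_meeting_def)
  have fB: "finite B" using B E finite_subset by blast
  have "card I \<le> i" using card_mono[OF fB B(1)] B by simp
  moreover have "card (I - X) \<le> card (B - X)" using B fB by (intro card_mono) auto
  moreover have "card (B - X) \<le> i - k" using card_Int_Diff[OF fB, of X] B by simp
  ultimately show "I \<subseteq> E \<and> card I \<le> i \<and> card (I - X) \<le> i - k" using B by simp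
next
  have E: "finite E" "X \<subseteq> E" "k \<le> card X" "k \<le> i" "i - k \<le> card (E - X)"
    using assms by (simp_all add: meeting_bounds_def)
  have fX: "finite X" using E finite_subset by blast
  assume "I \<subseteq> E \<and> card I \<le> i \<and> card (I - X) \<le> i - k"
  then have I: "I \<subseteq> E" "card I \<le> i" "card (I - X) \<le> i - k" by simp_all
  have fI: "finite I" using I E finite_subset by blast
  obtain T where T: "I - X \<subseteq> T" "T \<subseteq> E - X" "card T = i - k"
    using exists_subset_between[of "I - X" "i - k" "E - X"] I E by auto
  have fT: "finite T" using T E finite_subset by blast
  show "matroid_indep (bases_meeting E X i k) I"
  proof (cases "card (I \<inter> X) \<le> k")
    case True
    obtain W where W: "I \<inter> X \<subseteq> W" "W \<subseteq> X" "card W = k"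
      using exists_subset_between[of "I \<inter> X" k X] True E fX by auto
    have "finite W" using W(2) fX by (rule finite_subset)
    moreover have "W \<inter> T = {}" using W T by auto
    ultimately have "card (W \<union> T) = i"
      using card_Un_disjoint[of W T] fT W T E by simp
    moreover have "(W \<union> T) \<inter> X = W" using W T by auto
    ultimately have "W \<union> T \<in> bases_meeting E X i k"
      using W T E by (auto simp: bases_meeting_def)
    moreover have "I \<subseteq> W \<union> T" using W T by auto
    ultimately show ?thesis by (auto simp: matroid_indep_def)
  next
    case False
    have "card (I \<inter> X \<union> T) = card (I \<inter> X) + card T"
      using T fI fT by (intro card_Un_disjoint) auto
    then have "i \<le> card (I \<inter> X \<union> T)" using False T by simp
    moreover have "I \<subseteq> I \<inter> X \<union> T" using T by auto
    ultimately obtain B where B: "I \<subseteq> B" "B \<subseteq> I \<inter> X \<union> T" "card B = i"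
      using exists_subset_between[of I i "I \<inter> X \<union> T"] I fI fT by auto
    have "finite B" using B fI fT finite_subset by blast
    then have "card (I \<inter> X) \<le> card (B \<inter> X)" using B by (intro card_mono) auto
    then have "B \<in> bases_meeting E X i k"
      using B I T False by (auto simp: bases_meeting_def)
    then show ?thesis using B by (auto simp: matroid_indep_def)
  qed
qed

text \<open>
A maximal independent subset of \<open>Y\<close> takes all of \<open>Y \<inter> X\<close> and up to \<open>i - k\<close> elements outside \<open>X\<close>,
truncated to size \<open>i\<close>.
\<close>

lemma rank_bases_meeting:
  assumes m: "meeting_bounds E X i k" and Y: "Y \<subseteq> E"
  shows "matroid_rank (bases_meeting E X i k) Y = min i (card (Y \<inter> X) + min (card (Y - X)) (i - k))"
proof -
  have fY: "finite Y" using m Y finite_subset by (auto simp: meeting_bounds_def)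
  let ?I = "{I. matroid_indep (bases_meeting E X i k) I \<and> I \<subseteq> Y}"
  let ?r = "min i (card (Y \<inter> X) + min (card (Y - X)) (i - k))"
  have I: "?I = {I. I \<subseteq> Y \<and> card I \<le> i \<and> card (I - X) \<le> i - k}"
    using indep_bases_meeting_iff[OF m] Y by blast
  show ?thesis
    unfolding matroid_rank_def
  proof (rule Max_eqI)
    show "finite (card ` ?I)" using fY by simp
    fix r assume "r \<in> card ` ?I"
    then obtain J where J: "r = card J" "J \<subseteq> Y" "card J \<le> i" "card (J - X) \<le> i - k"
      unfolding I by blast
    have "card (J \<inter> X) \<le> card (Y \<inter> X)" "card (J - X) \<le> card (Y - X)"
      using J fY by (auto intro!: card_mono)
    moreover have "card J = card (J \<inter> X) + card (J - X)"
      using J fY finite_subset by (intro card_Int_Diff) blast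
    ultimately show "r \<le> ?r" using J by simp
  next
    obtain T where T: "T \<subseteq> Y - X" "card T = min (card (Y - X)) (i - k)" "finite T"
      using obtain_subset_with_card_n[of "min (card (Y - X)) (i - k)" "Y - X"] by auto
    have "card (Y \<inter> X \<union> T) = card (Y \<inter> X) + card T"
      using T fY by (intro card_Un_disjoint) auto
    then have "?r \<le> card (Y \<inter> X \<union> T)" unfolding T(2) by simp
    then obtain J where J: "J \<subseteq> Y \<inter> X \<union> T" "card J = ?r"
      by (rule obtain_subset_with_card_n)
    have "J - X \<subseteq> T" using J(1) by blast
    from card_mono[OF T(3) this] have "card (J - X) \<le> i - k" unfolding T(2) by simp
    moreover have "card J \<le> i" unfolding J(2) by simp
    moreover have "J \<subseteq> Y" using J(1) T(1) by blast
    ultimately have "J \<in> ?I" unfolding I by blast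
    then show "?r \<in> card ` ?I" unfolding J(2)[symmetric] by (rule imageI)
  qed
qed

text \<open>
In the exchange, any \<open>y\<close> is admissible unless \<open>x \<in> X\<close> is needed for the bound \<open>k\<close>. In that case \<open>B\<close>
has at least as many elements in \<open>X\<close> as \<open>A\<close>, hence one in \<open>X\<close> that is not in \<open>A\<close>.
\<close>

lemma matroid_bases_meeting:
  assumes m: "meeting_bounds E X i k"
  shows "matroid E (bases_meeting E X i k)"
  unfolding matroid_def
proof (intro conjI ballI)
  show E: "finite E" using m by (simp add: meeting_bounds_def)
  have "matroid_indep (bases_meeting E X i k) {}"
    unfolding indep_bases_meeting_iff[OF m] by simp
  then show "bases_meeting E X i k \<noteq> {}" by (auto simp: matroid_indep_def)
  show "B \<subseteq> E" if "B \<in> bases_meeting E X i k" for B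
    using that by (simp add: bases_meeting_def)
  fix A B x assume A: "A \<in> bases_meeting E X i k" and B: "B \<in> bases_meeting E X i k"
    and x: "x \<in> A - B"
  have A': "A \<subseteq> E" "card A = i" "k \<le> card (A \<inter> X)"
    and B': "B \<subseteq> E" "card B = i" "k \<le> card (B \<inter> X)"
    using A B by (simp_all add: bases_meeting_def)
  have fin: "finite A" "finite B" using A'(1) B'(1) E by (auto intro: finite_subset)
  have exch: "insert y (A - {x}) \<in> bases_meeting E X i k"
    if y: "y \<in> B - A" "k \<le> card (insert y (A - {x}) \<inter> X)" for y
  proof -
    have "card (insert y (A - {x})) = i"
      using x y(1) fin A'(2) card_Suc_Diff1[of A x] by simp
    moreover have "insert y (A - {x}) \<subseteq> E" using A'(1) B'(1) y(1) by blast
    ultimately show ?thesis using y(2) by (simp add: bases_meeting_def)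
  qed
  show "\<exists>y\<in>B - A. insert y (A - {x}) \<in> bases_meeting E X i k"
  proof (cases "x \<in> X \<and> card (A \<inter> X) = k")
    case True
    have "A \<inter> X \<inter> B \<subset> A \<inter> X" using True x by blast
    then have "card (A \<inter> X \<inter> B) < card (A \<inter> X)"
      by (rule psubset_card_mono[rotated]) (use fin in simp)
    also have "\<dots> \<le> card (B \<inter> X)" using True B'(3) by simp
    finally have "\<not> B \<inter> X \<subseteq> A \<inter> X \<inter> B"
      using card_mono[of "A \<inter> X \<inter> B" "B \<inter> X"] fin by auto
    then obtain y where y: "y \<in> B - A" "y \<in> X" by blast
    have "insert y (A - {x}) \<inter> X = insert y (A \<inter> X - {x})" using y by blast
    moreover have "card (insert y (A \<inter> X - {x})) = card (A \<inter> X)"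
      using True x y fin card_Suc_Diff1[of "A \<inter> X" x] by simp
    ultimately show ?thesis using exch[OF y(1)] y(1) True by auto
  next
    case False
    have "A \<inter> B \<subset> A" using x by blast
    then have "card (A \<inter> B) < card B"
      using psubset_card_mono[OF fin(1)] A'(2) B'(2) by simp
    then have "\<not> B \<subseteq> A \<inter> B" using card_mono[of "A \<inter> B" B] fin by auto
    then obtain y where y: "y \<in> B - A" by blast
    have "k \<le> card (A \<inter> X - {x})"
      using False A'(3) fin by (auto simp: card_Diff_singleton_if)
    also have "\<dots> \<le> card (insert y (A - {x}) \<inter> X)"
      using fin by (intro card_mono) auto
    finally show ?thesis using exch[OF y] y by blast
  qed
qed

text \<open>
A point outside a flat \<open>F\<close> raises the rank if it lies in \<open>X\<close> and the rank of \<open>F\<close> is not full, or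
if it lies outside \<open>X\<close> and, moreover, \<open>F\<close> has fewer than \<open>i - k\<close> elements there. Both conditions
persist when \<open>i\<close> grows by one and \<open>i - k\<close> stays the same or grows by one.
\<close>

lemma quotient_bases_meeting:
  assumes m: "meeting_bounds E X i k" and m': "meeting_bounds E X (Suc i) k'"
    and k': "k' = k \<or> k' = Suc k"
  shows "matroid_quotient E (bases_meeting E X i k) (bases_meeting E X (Suc i) k')"
  unfolding matroid_quotient_def
proof (intro conjI allI impI matroid_bases_meeting m m')
  fix F assume flat: "matroid_flat E (bases_meeting E X i k) F"
  then have F: "F \<subseteq> E" by (simp add: matroid_flat_def)
  have fF: "finite F" using F m finite_subset by (auto simp: meeting_bounds_def)
  have ki: "k \<le> i" using m by (simp add: meeting_bounds_def)
  show "matroid_flat E (bases_meeting E X (Suc i) k') F"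
    unfolding matroid_flat_def
  proof (intro conjI ballI F)
    fix x assume x: "x \<in> E - F"
    then have xF: "insert x F \<subseteq> E" using F by auto
    have "matroid_rank (bases_meeting E X i k) F < matroid_rank (bases_meeting E X i k) (insert x F)"
      using flat x by (simp add: matroid_flat_def)
    then show "matroid_rank (bases_meeting E X (Suc i) k') F
             < matroid_rank (bases_meeting E X (Suc i) k') (insert x F)"
      unfolding rank_bases_meeting[OF m F] rank_bases_meeting[OF m xF]
        rank_bases_meeting[OF m' F] rank_bases_meeting[OF m' xF]
      using x fF k' ki by (cases "x \<in> X") (auto simp: min_def insert_Diff_if split: if_splits)
  qed
qed

section \<open>Lattice path matroids\<close>

text \<open>
Comparing \<open>i\<close>-th smallest elements amounts to counting elements below thresholds, where
membership in a lattice path matroid becomes a system of inequalities.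
\<close>

lemma sorted_list_of_set_nth_le_iff:
  fixes S :: "nat set"
  assumes S: "finite S" and i: "i < card S"
  shows "sorted_list_of_set S ! i \<le> m \<longleftrightarrow> i < card (S \<inter> {..m})"
proof -
  let ?x = "\<lambda>l. sorted_list_of_set S ! l"
  have mono: "?x l \<le> ?x l'" if "l \<le> l'" "l' < card S" for l l'
    using that S by (intro sorted_nth_mono) auto
  have bij: "bij_betw ?x {..<card S} S"
    using bij_betw_nth[of "sorted_list_of_set S" "{..<card S}" S] S by simp
  have "bij_betw ?x {l \<in> {..<card S}. ?x l \<le> m} (S \<inter> {..m})"
    using bij by (auto simp: bij_betw_def inj_on_def)
  then have c: "card (S \<inter> {..m}) = card {l \<in> {..<card S}. ?x l \<le> m}"
    by (simp add: bij_betw_same_card)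
  show ?thesis
  proof
    assume "?x i \<le> m"
    then have "{..i} \<subseteq> {l \<in> {..<card S}. ?x l \<le> m}"
      using mono i by (auto intro: order_trans)
    then have "card {..i} \<le> card (S \<inter> {..m})" unfolding c by (intro card_mono) auto
    then show "i < card (S \<inter> {..m})" by simp
  next
    assume lt: "i < card (S \<inter> {..m})"
    show "?x i \<le> m"
    proof (rule ccontr)
      assume "\<not> ?x i \<le> m"
      then have "{l \<in> {..<card S}. ?x l \<le> m} \<subseteq> {..<i}"
        using mono[of i] by (force simp: not_le[symmetric])
      then have "card (S \<inter> {..m}) \<le> card {..<i}" unfolding c by (intro card_mono) auto
      then show False using lt by simp
    qed
  qed
qed

lemma gale_le_iff_card:
  assumes U: "finite U" and L: "finite L"
  shows "gale_le U L \<longleftrightarrow> card U = card L \<and> (\<forall>m. card (L \<inter> {..m}) \<le> card (U \<inter> {..m}))"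
proof (intro iffI conjI allI)
  assume g: "gale_le U L"
  then show c: "card U = card L" by (simp add: gale_le_def)
  fix m
  show "card (L \<inter> {..m}) \<le> card (U \<inter> {..m})"
  proof (cases "card (L \<inter> {..m})")
    case (Suc d)
    have "d < card L" using Suc card_mono[of L "L \<inter> {..m}"] L by simp
    moreover have "sorted_list_of_set L ! d \<le> m"
      using sorted_list_of_set_nth_le_iff[OF L \<open>d < card L\<close>] Suc by simp
    ultimately have "sorted_list_of_set U ! d \<le> m"
      using g c order_trans unfolding gale_le_def by metis
    then show ?thesis
      using sorted_list_of_set_nth_le_iff[OF U, of d m] \<open>d < card L\<close> c Suc by simp
  qed simp
next
  assume h: "card U = card L \<and> (\<forall>m. card (L \<inter> {..m}) \<le> card (U \<inter> {..m}))"
  show "gale_le U L"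
    unfolding gale_le_def
  proof (intro conjI allI impI U L)
    fix i assume i: "i < card U"
    then have "i < card (L \<inter> {..sorted_list_of_set L ! i})"
      using sorted_list_of_set_nth_le_iff[OF L, of i "sorted_list_of_set L ! i"] h by simp
    then have "i < card (U \<inter> {..sorted_list_of_set L ! i})" using h order_less_le_trans by blast
    then show "sorted_list_of_set U ! i \<le> sorted_list_of_set L ! i"
      using sorted_list_of_set_nth_le_iff[OF U i] by simp
  qed (use h in simp)
qed

lemma card_Int_atMost_bounds:
  fixes B :: "nat set"
  assumes B: "B \<subseteq> {1..n}"
  shows "card (B \<inter> {..m}) \<le> m" "card (B \<inter> {..m}) \<le> card B"
    "card B \<le> card (B \<inter> {..m}) + (n - m)"
    "j \<le> m \<Longrightarrow> card (B \<inter> {..j}) \<le> card (B \<inter> {..m})"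
    "j \<le> m \<Longrightarrow> card (B \<inter> {..m}) \<le> card (B \<inter> {..j}) + (m - j)"
proof -
  have fB: "finite B" using B finite_subset by blast
  show "card (B \<inter> {..m}) \<le> m"
    using card_mono[of "{1..m}" "B \<inter> {..m}"] B by fastforce
  show "card (B \<inter> {..m}) \<le> card B" using fB by (intro card_mono) auto
  have "card B \<le> card (B \<inter> {..m} \<union> {Suc m..n})"
    using B fB by (intro card_mono) (auto simp: not_le)
  also have "\<dots> \<le> card (B \<inter> {..m}) + card {Suc m..n}" by (rule card_Un_le)
  finally show "card B \<le> card (B \<inter> {..m}) + (n - m)" by simp
  assume "j \<le> m"
  then show "card (B \<inter> {..j}) \<le> card (B \<inter> {..m})" using fB by (intro card_mono) auto
  have "card (B \<inter> {..m}) \<le> card (B \<inter> {..j} \<union> {Suc j..m})"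
    using fB by (intro card_mono) (auto simp: not_le)
  also have "\<dots> \<le> card (B \<inter> {..j}) + card {Suc j..m}" by (rule card_Un_le)
  finally show "card (B \<inter> {..m}) \<le> card (B \<inter> {..j}) + (m - j)" by simp
qed

lemma card_two_blocks_Int_atMost:
  fixes a b c d m :: nat
  assumes "b \<le> c"
  shows "card (({a<..b} \<union> {c<..d}) \<inter> {..m}) = (min b m - a) + (min d m - c)"
proof -
  have "({a<..b} \<union> {c<..d}) \<inter> {..m} = {a<..min b m} \<union> {c<..min d m}" by auto
  moreover have "card ({a<..min b m} \<union> {c<..min d m}) = card {a<..min b m} + card {c<..min d m}"
    using assms by (intro card_Un_disjoint) auto
  ultimately show ?thesis by simp
qed

text \<open>
The upper path is the lexicographically first set. The lower path consists of the last \<open>k\<close> positions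
of \<open>{1..j}\<close> and the last \<open>i - k\<close> positions of \<open>{1..n}\<close>: this is the Gale-greatest base, and the
only one of its counting conditions that is not automatic is the one at the threshold \<open>j\<close>.
\<close>

lemma is_LPM_bases_meeting_initial:
  assumes j: "j \<le> n" and k: "k \<le> j" "k \<le> i" "i - k \<le> n - j"
  shows "is_LPM n (bases_meeting {1..n} {1..j} i k)"
proof -
  let ?U = "{0<..i}" and ?L = "{j - k<..j} \<union> {n - (i - k)<..n}"
  have block: "j \<le> n - (i - k)" using j k by simp
  have cU: "card (?U \<inter> {..m}) = min i m" for m
    using card_two_blocks_Int_atMost[of i i 0 i m] by simp
  have cL: "card (?L \<inter> {..m}) = (min j m - (j - k)) + (min n m - (n - (i - k)))" for m
    by (rule card_two_blocks_Int_atMost[OF block])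
  have "card ?L = card (?L \<inter> {..n})" using j by (intro arg_cong[where f = card]) auto
  then have L: "card ?L = i" using cL[of n] j k by simp
  have eq: "B \<in> bases_meeting {1..n} {1..j} i k \<longleftrightarrow> B \<in> lattice_path_matroid n ?U ?L"
    if B: "B \<subseteq> {1..n}" for B
  proof -
    have fB: "finite B" using B finite_subset by blast
    have Bj: "B \<inter> {1..j} = B \<inter> {..j}" using B by auto
    have "card B = i \<Longrightarrow> gale_le ?U B"
      using fB card_Int_atMost_bounds(1,2)[OF B] by (auto simp: gale_le_iff_card cU)
    moreover have "gale_le B ?L \<longleftrightarrow> k \<le> card (B \<inter> {..j})" if Bi: "card B = i"
    proof
      assume "gale_le B ?L"
      then have "card (?L \<inter> {..j}) \<le> card (B \<inter> {..j})" using fB by (simp add: gale_le_iff_card)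
      then show "k \<le> card (B \<inter> {..j})" unfolding cL using j k by simp
    next
      assume kB: "k \<le> card (B \<inter> {..j})"
      have "(min j m - (j - k)) + (min n m - (n - (i - k))) \<le> card (B \<inter> {..m})" for m
      proof (cases "m \<le> j")
        case True
        then show ?thesis
          using card_Int_atMost_bounds(5)[OF B True] kB block by simp
      next
        case False
        then show ?thesis
          using card_Int_atMost_bounds(4)[OF B, of j m] card_Int_atMost_bounds(3)[OF B, of m] kB Bi k j
          by (auto simp: min_def)
      qed
      then show "gale_le B ?L" using fB L Bi by (simp add: gale_le_iff_card cL)
    qed
    moreover have "gale_le B ?L \<Longrightarrow> card B = i" using L by (simp add: gale_le_def)
    ultimately show ?thesis
      using B unfolding bases_meeting_def lattice_path_matroid_def mem_Collect_eq Bj by blast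
  qed
  have "bases_meeting {1..n} {1..j} i k = lattice_path_matroid n ?U ?L"
    using eq by (auto simp: bases_meeting_def lattice_path_matroid_def)
  moreover have "?U \<subseteq> {1..n}" "?L \<subseteq> {1..n}" using j k by auto
  moreover have "gale_le ?U ?L"
    using L card_Int_atMost_bounds(1,2)[OF \<open>?L \<subseteq> {1..n}\<close>] by (simp add: gale_le_iff_card cU)
  ultimately show ?thesis unfolding is_LPM_def by blast
qed

text \<open>
Dually, the lower path is the last \<open>i\<close>-set, and the upper path is the Gale-least base, which
consists of the first \<open>i - k\<close> positions and the first \<open>k\<close> positions after \<open>j\<close>.
\<close>

lemma is_LPM_bases_meeting_final:
  assumes j: "j \<le> n" and k: "k \<le> n - j" "k \<le> i" "i - k \<le> j"
  shows "is_LPM n (bases_meeting {1..n} {Suc j..n} i k)"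
proof -
  let ?U = "{0<..i - k} \<union> {j<..j + k}" and ?L = "{n - i<..n}"
  have cU: "card (?U \<inter> {..m}) = min (i - k) m + (min (j + k) m - j)" for m
    using card_two_blocks_Int_atMost[OF k(3), of 0 "j + k" m] by simp
  have cL: "card (?L \<inter> {..m}) = min n m - (n - i)" for m
    using card_two_blocks_Int_atMost[of n n "n - i" n m] by simp
  have L: "card ?L = i" using j k by simp
  have "card ?U = card (?U \<inter> {..j + k})" using k by (intro arg_cong[where f = card]) auto
  then have U: "card ?U = i" using cU[of "j + k"] k by simp
  have galeL: "gale_le B ?L" if "B \<subseteq> {1..n}" "card B = i" for B
  proof -
    have "finite B" using that finite_subset by blast
    moreover have "min n m - (n - i) \<le> card (B \<inter> {..m})" for m
      using card_Int_atMost_bounds(3)[OF that(1), of m] that(2) by simp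
    ultimately show ?thesis using that(2) L by (simp add: gale_le_iff_card cL)
  qed
  have eq: "B \<in> bases_meeting {1..n} {Suc j..n} i k \<longleftrightarrow> B \<in> lattice_path_matroid n ?U ?L"
    if B: "B \<subseteq> {1..n}" for B
  proof -
    have fB: "finite B" using B finite_subset by blast
    have "B - {..j} = B \<inter> {Suc j..n}" using B by auto
    then have Bj: "card B = card (B \<inter> {..j}) + card (B \<inter> {Suc j..n})"
      using card_Int_Diff[OF fB, of "{..j}"] by simp
    have "gale_le ?U B \<longleftrightarrow> k \<le> card (B \<inter> {Suc j..n})" if Bi: "card B = i"
    proof
      assume "gale_le ?U B"
      then have "card (B \<inter> {..j}) \<le> card (?U \<inter> {..j})" using fB by (simp add: gale_le_iff_card)
      then show "k \<le> card (B \<inter> {Suc j..n})" unfolding cU using Bj Bi k by simp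
    next
      assume "k \<le> card (B \<inter> {Suc j..n})"
      then have kB: "card (B \<inter> {..j}) \<le> i - k" using Bj Bi by simp
      have "card (B \<inter> {..m}) \<le> min (i - k) m + (min (j + k) m - j)" for m
      proof (cases "m \<le> j")
        case True
        then show ?thesis
          using card_Int_atMost_bounds(1)[OF B, of m] card_Int_atMost_bounds(4)[OF B True] kB by simp
      next
        case False
        then show ?thesis
          using card_Int_atMost_bounds(5)[OF B, of j m] card_Int_atMost_bounds(2)[OF B, of m] kB Bi k
          by (auto simp: min_def)
      qed
      then show "gale_le ?U B" using fB U Bi by (simp add: gale_le_iff_card cU)
    qed
    moreover have "gale_le B ?L \<Longrightarrow> card B = i" using L by (simp add: gale_le_def)
    ultimately show ?thesis
      using B galeL[OF B] by (auto simp: bases_meeting_def lattice_path_matroid_def)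
  qed
  have "bases_meeting {1..n} {Suc j..n} i k = lattice_path_matroid n ?U ?L"
    using eq by (auto simp: bases_meeting_def lattice_path_matroid_def)
  moreover have "?U \<subseteq> {1..n}" "?L \<subseteq> {1..n}" using j k by auto
  moreover have "gale_le ?U ?L" using galeL[OF \<open>?U \<subseteq> {1..n}\<close> U] .
  ultimately show ?thesis unfolding is_LPM_def by blast
qed

lemma is_LPFM_bases_meeting:
  assumes m: "\<And>i. i \<le> n \<Longrightarrow> meeting_bounds {1..n} X i (k i)"
    and step: "\<And>i. i < n \<Longrightarrow> k (Suc i) = k i \<or> k (Suc i) = Suc (k i)"
    and lpm: "\<And>i. i \<le> n \<Longrightarrow> is_LPM n (bases_meeting {1..n} X i (k i))"
  shows "is_LPFM n (\<lambda>i. bases_meeting {1..n} X i (k i))"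
  unfolding is_LPFM_def
proof (intro conjI ballI)
  fix i assume i: "i \<in> {1..n}"
  then show "is_LPM n (bases_meeting {1..n} X i (k i))" using lpm by simp
  have mi: "meeting_bounds {1..n} X i (k i)" using m i by simp
  then have "X \<subseteq> {1..n}" "k i \<le> card X" "k i \<le> i" "i - k i \<le> card ({1..n} - X)"
    by (simp_all add: meeting_bounds_def)
  then show "matroid_rank (bases_meeting {1..n} X i (k i)) {1..n} = i"
    using rank_bases_meeting[OF mi order_refl] by (simp add: Int_absorb1)
next
  fix i assume "i \<in> {1..<n}"
  then show "matroid_quotient {1..n} (bases_meeting {1..n} X i (k i))
      (bases_meeting {1..n} X (Suc i) (k (Suc i)))"
    using m step by (intro quotient_bases_meeting) auto
qed

section \<open>Flag matroid polytopes as halves of the permutahedron\<close>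

lemma inner_indicator_perm_point:
  assumes X: "X \<subseteq> {1..CARD('n)}"
  shows "(indicator_point X :: real ^ 'n::{finite,linorder}) \<bullet> perm_point z = real (\<Sum>k\<in>X. z k)"
proof -
  have "(indicator_point X :: (real, 'n) vec) \<bullet> perm_point z
      = (\<Sum>k\<in>{1..CARD('n)}. if k \<in> X then real (z k) else 0)"
    unfolding inner_perm_point by (intro sum.cong) (auto simp: indicator_point_coord_at)
  also have "\<dots> = (\<Sum>k\<in>X. real (z k))"
    using X by (simp flip: sum.inter_restrict add: Int_absorb1)
  finally show ?thesis by simp
qed

lemma inner_indicator_indicator_point:
  assumes B: "B \<subseteq> {1..CARD('n)}"
  shows "(indicator_point X :: real ^ 'n::{finite,linorder}) \<bullet> indicator_point B = real (card (B \<inter> X))"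
proof -
  have fB: "finite B" using B finite_subset by blast
  have "(indicator_point X :: (real, 'n) vec) \<bullet> indicator_point B = (\<Sum>k\<in>B. if k \<in> X then 1 else 0)"
    unfolding inner_indicator_point[OF B]
    using B by (intro sum.cong) (auto simp: indicator_point_coord_at subset_iff)
  also have "\<dots> = real (card (B \<inter> X))"
    using fB by (simp flip: sum.inter_restrict)
  finally show ?thesis .
qed

lemma inner_complement_permutahedron:
  fixes x :: "real ^ 'n::{finite,linorder}"
  assumes x: "x \<in> permutahedron" and X: "X \<subseteq> {1..CARD('n)}"
  shows "indicator_point ({1..CARD('n)} - X) \<bullet> x = real (\<Sum>{1..CARD('n)}) - indicator_point X \<bullet> x"
proof -
  let ?c = "indicator_point X + indicator_point ({1..CARD('n)} - X) :: (real, 'n) vec"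
  have "?c \<bullet> perm_point z = real (\<Sum>{1..CARD('n)})" if z: "z permutes {1..CARD('n)}" for z
  proof -
    have "(\<Sum>k\<in>X. z k) + (\<Sum>k\<in>{1..CARD('n)} - X. z k) = (\<Sum>k\<in>{1..CARD('n)}. z k)"
      using X sum.subset_diff[OF X, of z] by (simp add: add.commute)
    also have "\<dots> = \<Sum>{1..CARD('n)}"
      using sum.permute[OF z, of "\<lambda>k. k"] by simp
    finally show ?thesis
      by (simp only: inner_add_left inner_indicator_perm_point[OF X] inner_indicator_perm_point[OF Diff_subset]
          of_nat_add[symmetric])
  qed
  then have "permutahedron \<subseteq> {x. ?c \<bullet> x = real (\<Sum>{1..CARD('n)})}"
    unfolding permutahedron_def by (intro hull_minimal convex_hyperplane) auto
  then show ?thesis using x by (auto simp: inner_add_left)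
qed

lemma perm_point_eq_sum_indicator_point:
  assumes z: "z permutes {1..CARD('n)}"
  shows "(perm_point z :: real ^ 'n::{finite,linorder})
       = (\<Sum>i\<in>{1..CARD('n)}. indicator_point (top_positions CARD('n) z i))"
proof -
  have "c \<bullet> perm_point z = c \<bullet> (\<Sum>i\<in>{1..CARD('n)}. indicator_point (top_positions CARD('n) z i))"
    for c :: "(real, 'n) vec"
    unfolding inner_sum_right inner_indicator_point[OF top_positions_subset] inner_perm_point
      sum_top_positions[OF z] ..
  then show ?thesis using vector_eq_ldot by blast
qed

lemma matroid_polytope_le:
  fixes c :: "real ^ 'n::{finite,linorder}"
  assumes "x \<in> matroid_polytope M" and "\<And>B. B \<in> M \<Longrightarrow> c \<bullet> indicator_point B \<le> d"
  shows "c \<bullet> x \<le> d"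
proof -
  have "matroid_polytope M \<subseteq> {x. c \<bullet> x \<le> d}"
    unfolding matroid_polytope_def by (intro hull_minimal convex_halfspace_le) (use assms(2) in auto)
  then show ?thesis using assms(1) by auto
qed

lemma flag_matroid_polytope_decompose:
  fixes x :: "real ^ 'n::{finite,linorder}"
  assumes "x \<in> flag_matroid_polytope M"
  shows "\<exists>y. x = (\<Sum>i\<in>{1..CARD('n)}. y i) \<and> (\<forall>i\<in>{1..CARD('n)}. y i \<in> matroid_polytope (M i))"
  using assms unfolding flag_matroid_polytope_def set_sum_alt[OF finite_atLeastAtMost] by blast

text \<open>
Only the ranks of the matroids matter: a functional attains its maximum over a Minkowski sum
summand by summand, and each summand is bounded by the set of top positions of one and the same
permutation.
\<close>

lemma flag_matroid_polytope_subset_permutahedron: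
  assumes M: "\<And>i B. i \<in> {1..CARD('n)} \<Longrightarrow> B \<in> M i \<Longrightarrow> B \<subseteq> {1..CARD('n)} \<and> card B = i"
  shows "(flag_matroid_polytope M :: (real ^ 'n::{finite,linorder}) set) \<subseteq> permutahedron"
proof
  let ?n = "CARD('n)"
  fix x :: "(real, 'n) vec" assume "x \<in> flag_matroid_polytope M"
  from flag_matroid_polytope_decompose[OF this]
  obtain y where x: "x = (\<Sum>i\<in>{1..?n}. y i)"
    and y: "\<forall>i\<in>{1..?n}. y i \<in> matroid_polytope (M i)" by blast
  show "x \<in> permutahedron"
  proof (rule ccontr)
    assume "x \<notin> permutahedron"
    moreover have "closed (permutahedron :: (real, 'n) vec set)"
      unfolding permutahedron_def
      by (intro compact_imp_closed finite_imp_compact_convex_hull finite_imageI finite_permutations) simp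
    moreover have "convex (permutahedron :: (real, 'n) vec set)"
      unfolding permutahedron_def by (rule convex_convex_hull)
    ultimately obtain c d where c: "c \<bullet> x < d" "\<forall>y\<in>permutahedron. c \<bullet> y > d"
      using separating_hyperplane_closed_point[of permutahedron x] by blast
    let ?w = "\<lambda>k. (- c) $ coord_at k"
    obtain z where z: "z permutes {1..?n}"
      and adj: "\<forall>k\<in>{1..?n}. \<forall>l\<in>{1..?n}. z l = Suc (z k) \<longrightarrow> ?w k \<le> ?w l"
      using exists_sorting_permutation[of ?n ?w] by blast
    have "(- c) \<bullet> y i \<le> (- c) \<bullet> indicator_point (top_positions ?n z i)" if i: "i \<in> {1..?n}" for i
    proof (rule matroid_polytope_le[OF bspec[OF y i]])
      fix B assume "B \<in> M i"
      then have B: "B \<subseteq> {1..?n}" "card B = i" using M[OF i] by blast+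
      show "(- c) \<bullet> indicator_point B \<le> (- c) \<bullet> indicator_point (top_positions ?n z i)"
        unfolding inner_indicator_point[OF B(1)] inner_indicator_point[OF top_positions_subset]
        using top_positions_maximise[OF z _ B(1), of ?w] adj B(2) by blast
    qed
    then have "(- c) \<bullet> x \<le> (- c) \<bullet> perm_point z"
      unfolding x perm_point_eq_sum_indicator_point[OF z] inner_sum_right by (rule sum_mono)
    moreover have "(perm_point z :: (real, 'n) vec) \<in> permutahedron"
      unfolding permutahedron_def using z by (intro hull_inc) auto
    ultimately show False using c by fastforce
  qed
qed

text \<open>
The Minkowski sum is compared with the half directly, so that its vertices need not be known:
permutations of the half decompose into bases, and sums of bases satisfy the inequality of the half.
\<close>

lemma is_LPFM_polytope_halfspace:
  fixes k :: "nat \<Rightarrow> nat" and F :: "(real ^ 'n::{finite,linorder}) set"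
  assumes X: "X \<subseteq> {1..CARD('n)}"
    and flag: "is_LPFM CARD('n) (\<lambda>i. bases_meeting {1..CARD('n)} X i (k i))"
    and F: "F = permutahedron \<inter> {x. indicator_point X \<bullet> x \<ge> real (\<Sum>i\<in>{1..CARD('n)}. k i)}"
    and hull: "F = convex hull (perm_point ` S)"
    and S: "\<And>z. z \<in> S \<Longrightarrow> z permutes {1..CARD('n)}"
    and top: "\<And>z i. z \<in> S \<Longrightarrow> i \<in> {1..CARD('n)} \<Longrightarrow> k i \<le> card (top_positions CARD('n) z i \<inter> X)"
  shows "is_LPFM_polytope F"
  unfolding is_LPFM_polytope_def
proof (intro exI conjI)
  let ?n = "CARD('n)" and ?a = "indicator_point X :: (real, 'n) vec"
  let ?M = "\<lambda>i. bases_meeting {1..?n} X i (k i)"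
  show "is_LPFM ?n ?M" by (rule flag)
  show "F = flag_matroid_polytope ?M"
  proof
    have "perm_point z \<in> (flag_matroid_polytope ?M :: (real, 'n) vec set)" if z: "z \<in> S" for z
    proof -
      have "indicator_point (top_positions ?n z i) \<in> (matroid_polytope (?M i) :: (real, 'n) vec set)"
        if i: "i \<in> {1..?n}" for i
      proof -
        have "top_positions ?n z i \<in> ?M i"
          using top[OF z i] card_top_positions[OF S[OF z], of i] top_positions_subset i
          by (simp add: bases_meeting_def)
        then show ?thesis unfolding matroid_polytope_def by (intro hull_inc imageI)
      qed
      then show ?thesis
        unfolding flag_matroid_polytope_def perm_point_eq_sum_indicator_point[OF S[OF z]]
          set_sum_alt[OF finite_atLeastAtMost] by blast
    qed
    moreover have "convex (flag_matroid_polytope ?M :: (real, 'n) vec set)"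
      unfolding flag_matroid_polytope_def matroid_polytope_def by (intro convex_set_sum convex_convex_hull)
    ultimately show "F \<subseteq> flag_matroid_polytope ?M"
      unfolding hull by (intro hull_minimal) auto
    show "flag_matroid_polytope ?M \<subseteq> F"
    proof
      fix x :: "(real, 'n) vec" assume x: "x \<in> flag_matroid_polytope ?M"
      then have "x \<in> permutahedron"
        using flag_matroid_polytope_subset_permutahedron[of ?M] by (auto simp: bases_meeting_def)
      from flag_matroid_polytope_decompose[OF x]
      obtain y where xy: "x = (\<Sum>i\<in>{1..?n}. y i)"
        and y: "\<forall>i\<in>{1..?n}. y i \<in> matroid_polytope (?M i)" by blast
      have "real (k i) \<le> ?a \<bullet> y i" if i: "i \<in> {1..?n}" for i
        using matroid_polytope_le[OF bspec[OF y i], of "- ?a" "- real (k i)"]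
        by (simp add: bases_meeting_def inner_indicator_indicator_point)
      then have "(\<Sum>i\<in>{1..?n}. real (k i)) \<le> ?a \<bullet> x"
        unfolding xy inner_sum_right by (rule sum_mono)
      then show "x \<in> F" using \<open>x \<in> permutahedron\<close> unfolding F by simp
    qed
  qed
qed

text \<open>
A split may be described by any functional that cuts out the same halves in the opposite order; this
transfers a split by a prefix sum to one by the last coordinate.
\<close>

lemma split_along_opposite:
  assumes split: "split_along P a b F1 F2" and "a' \<noteq> 0"
    and opp: "\<And>x. x \<in> P \<Longrightarrow> a' \<bullet> x - b' = b - a \<bullet> x"
  shows "split_along P a' b' F2 F1"
proof -
  have "P \<inter> {x. a' \<bullet> x \<ge> b'} = P \<inter> {x. a \<bullet> x \<le> b}" "P \<inter> {x. a' \<bullet> x \<le> b'} = P \<inter> {x. a \<bullet> x \<ge> b}"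
    using opp by (auto simp: algebra_simps) (smt (verit) opp)+
  moreover have "F2 \<inter> F1 \<subseteq> {x. a' \<bullet> x = b'}"
  proof
    fix x assume x: "x \<in> F2 \<inter> F1"
    then have "x \<in> P" "a \<bullet> x = b" using split by (auto simp: split_along_def)
    then show "x \<in> {x. a' \<bullet> x = b'}" using opp[of x] by simp
  qed
  ultimately show ?thesis
    using split \<open>a' \<noteq> 0\<close> unfolding split_along_def by (metis Int_commute insert_commute)
qed

section \<open>Splits from a prefix set determined by its sum\<close>

text \<open>
Sets of equal size that are separated by a threshold \<open>t\<close> differ in sum by at least the number of
exchanged elements. If the difference is one, a single pair has been exchanged, necessarily across
the threshold. With \<open>K\<close> or \<open>A\<close> an extreme set this shows that the sum next to the extreme one
determines the set.
\<close>

lemma sum_exchange_gap: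
  fixes A K :: "nat set"
  assumes fin: "finite A" "finite K" and card: "card A = card K"
    and le: "\<And>x. x \<in> K - A \<Longrightarrow> x \<le> t" and gt: "\<And>x. x \<in> A - K \<Longrightarrow> t < x"
  shows "\<Sum>K + card (A - K) \<le> \<Sum>A"
    and "\<Sum>A = Suc (\<Sum>K) \<Longrightarrow> K = insert t (A - {Suc t}) \<and> A = insert (Suc t) (K - {t})"
proof -
  have c: "card (K - A) = card (A - K)"
    using card_Diff_subset_Int[of A K] card_Diff_subset_Int[of K A] fin card by (simp add: Int_commute)
  have split: "\<Sum>K = \<Sum>(K \<inter> A) + \<Sum>(K - A)" "\<Sum>A = \<Sum>(K \<inter> A) + \<Sum>(A - K)"
    using fin sum.Int_Diff[of K "\<lambda>x. x" A] sum.Int_Diff[of A "\<lambda>x. x" K] by (simp_all add: Int_commute)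
  have "card (A - K) * Suc t \<le> \<Sum>(A - K)"
    using sum_bounded_below[of "A - K" "Suc t" "\<lambda>x. x"] gt by (simp add: Suc_le_eq)
  moreover have "\<Sum>(K - A) \<le> card (K - A) * t"
    using sum_bounded_above[of "K - A" "\<lambda>x. x" t] le by simp
  ultimately show gap: "\<Sum>K + card (A - K) \<le> \<Sum>A"
    unfolding split c by simp
  assume one: "\<Sum>A = Suc (\<Sum>K)"
  have "card (A - K) \<noteq> 0"
  proof
    assume "card (A - K) = 0"
    moreover from this have "card (K - A) = 0" using c by simp
    ultimately have "A - K = {}" "K - A = {}"
      using fin by (simp_all only: card_0_eq finite_Diff)
    then have "A = K" by auto
    then show False using one by simp
  qed
  then have "card (A - K) = 1" using gap one by simp
  then obtain x y where x: "A - K = {x}" and y: "K - A = {y}"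
    using c by (metis card_1_singletonE)
  have "x = Suc y" using one split x y by simp
  moreover have "y \<le> t" "t < x" using le gt x y by auto
  ultimately have "x = Suc t" "y = t" by simp_all
  then show "K = insert t (A - {Suc t}) \<and> A = insert (Suc t) (K - {t})"
    using x y by auto
qed

lemma sum_lt_of_unique_extreme:
  assumes A: "A \<subseteq> {1..n}"
  shows "A \<noteq> {1..card A} \<Longrightarrow> \<Sum>{1..card A} < \<Sum>A"
    and "A \<noteq> {n - card A + 1..n} \<Longrightarrow> \<Sum>A < \<Sum>{n - card A + 1..n}"
proof -
  have fA: "finite A" using A finite_subset by blast
  have cA: "card A \<le> n" using card_mono[OF _ A] by simp
  have pos: "0 < card (B - K)" if "finite B" "card B = card K" "finite K" "B \<noteq> K" for B K :: "nat set"
    using that card_subset_eq[of K B] by (auto simp: card_gt_0_iff)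
  {
    assume "A \<noteq> {1..card A}"
    then have "0 < card (A - {1..card A})" using fA by (intro pos) auto
    moreover have "\<Sum>{1..card A} + card (A - {1..card A}) \<le> \<Sum>A"
      by (rule sum_exchange_gap(1)[where t = "card A"]) (use A fA in auto)
    ultimately show "\<Sum>{1..card A} < \<Sum>A" by simp
  }
  {
    let ?T = "{n - card A + 1..n}"
    assume "A \<noteq> ?T"
    then have "0 < card (?T - A)" using fA cA by (intro pos) auto
    moreover have "\<Sum>A + card (?T - A) \<le> \<Sum>?T"
      by (rule sum_exchange_gap(1)[where t = "n - card A"]) (use A fA cA in auto)
    ultimately show "\<Sum>A < \<Sum>?T" by simp
  }
qed

lemma card_top_positions_Int:
  assumes "X \<subseteq> {1..n}"
  shows "card (top_positions n z i \<inter> X) = (\<Sum>p\<in>X. of_bool (n - i < z p))"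
proof -
  have "finite X" using assms finite_subset by blast
  moreover have "top_positions n z i \<inter> X = {p \<in> X. n - i < z p}"
    using assms by (auto simp: top_positions_def)
  ultimately show ?thesis by (simp add: of_bool_def sum.inter_filter[symmetric])
qed

text \<open>
The common source of all cases. The two extreme sets of each size are also determined by their sums,
but their hyperplanes only touch the permutahedron in a face.
\<close>

theorem split_of_unique_prefix_set:
  fixes a :: "real ^ 'n::{finite,linorder}"
  assumes A: "A \<subseteq> {1..CARD('n)}"
    and uniq: "\<And>B. B \<subseteq> {1..CARD('n)} \<Longrightarrow> card B = card A \<Longrightarrow> \<Sum>B = \<Sum>A \<Longrightarrow> B = A"
    and not_min: "A \<noteq> {1..card A}" and not_max: "A \<noteq> {CARD('n) - card A + 1..CARD('n)}"
    and a: "a = indicator_point {1..card A}" and b: "b = real (\<Sum>A)"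
  shows "split_along permutahedron a b (permutahedron \<inter> {x. a \<bullet> x \<ge> b}) (permutahedron \<inter> {x. a \<bullet> x \<le> b})"
    and "is_BIP (permutahedron \<inter> {x. a \<bullet> x \<ge> b})"
    and "is_BIP (permutahedron \<inter> {x. a \<bullet> x \<le> b})"
    and "is_LPFM_polytope (permutahedron \<inter> {x. a \<bullet> x \<ge> b})"
    and "is_LPFM_polytope (permutahedron \<inter> {x. a \<bullet> x \<le> b})"
proof -
  define n where "n = CARD('n)"
  define j where "j = card A"
  note A = A[folded n_def] and uniq = uniq[folded n_def]
    and not_min = not_min[folded j_def] and not_max = not_max[folded n_def j_def] and a = a[folded j_def]
  have fA: "finite A" using A finite_subset by blast
  have j: "j \<le> n" using card_mono[OF _ A] by (simp add: j_def)
  have pre: "{1..j} \<subseteq> {1..n}" using j by auto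
  let ?perms = "{z. z permutes {1..n}}"
  let ?V = "perm_point ` ?perms :: (real, 'n) vec set"
  have P: "permutahedron = convex hull ?V" by (simp add: permutahedron_def n_def)
  have val: "a \<bullet> perm_point z = real (\<Sum>k\<in>{1..j}. z k)" for z
    unfolding a by (rule inner_indicator_perm_point[OF pre[unfolded n_def]])
  have "(\<Sum>k\<in>{1..j}. id k) < \<Sum>A"
    using sum_lt_of_unique_extreme(1)[OF A] not_min by (simp add: j_def)
  then have lo: "id permutes {1..n}" "a \<bullet> perm_point id < b"
    unfolding val b by (simp_all only: permutes_id of_nat_less_iff)
  have hi: "rev_perm n permutes {1..n}" "a \<bullet> perm_point (rev_perm n) > b"
  proof -
    have "rev_perm n ` {1..j} = {n - j + 1..n}" by (rule rev_perm_image_prefix[OF j])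
    then show "a \<bullet> perm_point (rev_perm n) > b"
      using sum_lt_of_unique_extreme(2)[OF A] not_max
      unfolding val b prefix_sum_eq_sum_image[OF rev_perm_permutes] of_nat_less_iff j_def by metis
  qed (rule rev_perm_permutes)
  have slice: "convex hull ?V \<inter> {x. a \<bullet> x = b} \<subseteq> convex hull (?V \<inter> {x. a \<bullet> x = b})"
    using permutahedron_slice[OF a, of id "\<Sum>A" "rev_perm n"] lo hi unfolding P b n_def by blast
  have ge: "permutahedron \<inter> {x. a \<bullet> x \<ge> b} = convex hull (?V \<inter> {x. a \<bullet> x \<ge> b})"
    unfolding P by (rule convex_hull_Int_halfspace_ge[OF slice])
  have le: "permutahedron \<inter> {x. a \<bullet> x \<le> b} = convex hull (?V \<inter> {x. a \<bullet> x \<le> b})"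
    unfolding P by (rule convex_hull_Int_halfspace_le[OF slice])
  have mem: "(perm_point z :: (real, 'n) vec) \<in> permutahedron" if "z permutes {1..n}" for z
    unfolding P using that by (intro hull_inc) auto
  show "split_along permutahedron a b (permutahedron \<inter> {x. a \<bullet> x \<ge> b}) (permutahedron \<inter> {x. a \<bullet> x \<le> b})"
    unfolding P
  proof (rule split_alongI[OF _ _ slice])
    show "finite ?V" by (intro finite_imageI finite_permutations) simp
    show "v extreme_point_of convex hull ?V" if v: "v \<in> ?V" for v
    proof -
      from v obtain z where "v = perm_point z" and z: "z permutes {1..CARD('n)}"
        unfolding n_def by blast
      then show ?thesis unfolding P[symmetric] using extreme_point_permutahedron[OF z] by simp
    qed
    show "perm_point (rev_perm n) \<in> convex hull ?V" using mem[OF hi(1)] unfolding P .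
    show "perm_point id \<in> convex hull ?V" using mem[OF lo(1)] unfolding P .
  qed (rule lo hi)+
  obtain u where u: "u permutes {1..n}" "u ` {1..j} = A"
    and least: "\<And>z. z permutes {1..n} \<Longrightarrow> \<Sum>A \<le> (\<Sum>i\<in>{1..j}. z i) \<Longrightarrow> bruhat_le n u z"
    using ex_bruhat_least_of_unique_prefix[OF A uniq] unfolding j_def by blast
  obtain v where v: "v permutes {1..n}" "v ` {1..j} = A"
    and greatest: "\<And>z. z permutes {1..n} \<Longrightarrow> (\<Sum>i\<in>{1..j}. z i) \<le> \<Sum>A \<Longrightarrow> bruhat_le n z v"
    using ex_bruhat_greatest_of_unique_prefix[OF A uniq] unfolding j_def by blast
  obtain bot top where bot: "\<And>z. z permutes {1..n} \<Longrightarrow> bruhat_le n bot z"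
    and top: "\<And>z. z permutes {1..n} \<Longrightarrow> bruhat_le n z top"
    using ex_bruhat_least ex_bruhat_greatest by metis
  have usum: "(\<Sum>i\<in>{1..j}. u i) = \<Sum>A" and vsum: "(\<Sum>i\<in>{1..j}. v i) = \<Sum>A"
    using prefix_sum_eq_sum_image[OF u(1)] prefix_sum_eq_sum_image[OF v(1)] u(2) v(2) by simp_all
  have above: "bruhat_le n u z \<longleftrightarrow> z permutes {1..n} \<and> \<Sum>A \<le> (\<Sum>i\<in>{1..j}. z i)" for z
    using least bruhat_prefix_sum_mono[of n u z "\<lambda>x. x" j] usum by (auto simp: bruhat_le_def mono_def)
  have below: "bruhat_le n z v \<longleftrightarrow> z permutes {1..n} \<and> (\<Sum>i\<in>{1..j}. z i) \<le> \<Sum>A" for z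
    using greatest bruhat_prefix_sum_mono[of n z v "\<lambda>x. x" j] vsum by (auto simp: bruhat_le_def mono_def)
  have perm: "z permutes {1..n}" if "bruhat_le n y z \<or> bruhat_le n z y" for y z
    using that by (auto simp: bruhat_le_def)
  have Vge: "?V \<inter> {x. a \<bullet> x \<ge> b} = perm_point ` {z. bruhat_le n u z \<and> bruhat_le n z top}"
    using above top by (auto simp: val b simp del: of_nat_sum)
  have Vle: "?V \<inter> {x. a \<bullet> x \<le> b} = perm_point ` {z. bruhat_le n bot z \<and> bruhat_le n z v}"
    using below bot by (auto simp: val b simp del: of_nat_sum)
  show "is_BIP (permutahedron \<inter> {x. a \<bullet> x \<ge> b})"
    unfolding is_BIP_def bruhat_interval_polytope_def n_def[symmetric] ge Vge
    using top[OF u(1)] by blast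
  show "is_BIP (permutahedron \<inter> {x. a \<bullet> x \<le> b})"
    unfolding is_BIP_def bruhat_interval_polytope_def n_def[symmetric] le Vle
    using bot[OF v(1)] by blast
  \<comment> \<open>The top positions of the identity are the \<open>i\<close> largest numbers, so \<open>k i\<close> counts large values in \<open>A\<close>.\<close>
  define k where "k i = card (top_positions n id i \<inter> A)" for i
  have top_id: "finite (top_positions n id i)" for i by (simp add: top_positions_def)
  have card_id: "card (top_positions n id i) = i" if "i \<le> n" for i
    by (rule card_top_positions[OF permutes_id that])
  have kj: "k i \<le> j" for i unfolding k_def j_def using fA by (intro card_mono) auto
  have ki: "k i \<le> i" if "i \<le> n" for i
    using card_mono[OF top_id[of i], of "top_positions n id i \<inter> A"] card_id[OF that] by (simp add: k_def)
  have kc: "i - k i \<le> n - j" if "i \<le> n" for i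
  proof -
    have "card (top_positions n id i - A) \<le> card ({1..n} - A)"
      using top_positions_subset by (intro card_mono) auto
    also have "\<dots> = n - j" using A fA by (simp add: card_Diff_subset j_def)
    finally show ?thesis
      using card_Int_Diff[OF top_id[of i], of A] card_id[OF that] by (simp add: k_def)
  qed
  have kSuc: "k (Suc i) = k i \<or> k (Suc i) = Suc (k i)" if i: "i < n" for i
  proof -
    have "top_positions n id (Suc i) = insert (n - i) (top_positions n id i)"
      using i by (auto simp: top_positions_def)
    moreover have "n - i \<notin> top_positions n id i" by (simp add: top_positions_def)
    ultimately show ?thesis using top_id by (cases "n - i \<in> A") (simp_all add: k_def)
  qed
  have ksum: "(\<Sum>i\<in>{1..n}. k i) = \<Sum>A"
  proof -
    have "real (\<Sum>i\<in>{1..n}. k i) = (\<Sum>i\<in>{1..n}. \<Sum>p\<in>top_positions n id i. of_bool (p \<in> A))"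
      unfolding of_nat_sum
    proof (intro sum.cong refl)
      fix i
      show "real (k i) = (\<Sum>p\<in>top_positions n id i. of_bool (p \<in> A))"
        using top_id[of i] by (simp add: k_def of_bool_def sum.inter_restrict[symmetric])
    qed
    also have "\<dots> = (\<Sum>p\<in>{1..n}. of_bool (p \<in> A) * real (id p))"
      by (rule sum_top_positions[OF permutes_id])
    also have "\<dots> = (\<Sum>p\<in>{1..n}. if p \<in> A then real p else 0)"
      by (intro sum.cong) auto
    also have "\<dots> = (\<Sum>p\<in>A. real p)"
      using A by (simp flip: sum.inter_restrict add: Int_absorb1)
    finally have "real (\<Sum>i\<in>{1..n}. k i) = real (\<Sum>A)" by simp
    then show ?thesis by (simp only: of_nat_eq_iff)
  qed
  \<comment> \<open>The least element of one half and the greatest of the other have prefix values \<open>A\<close> and hence attain the bounds \<open>k i\<close>.\<close>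
  have k_eq: "(\<Sum>p\<in>{1..j}. of_bool (n - i < y p)) = k i"
    if y: "y permutes {1..n}" "y ` {1..j} = A" for y i
  proof -
    have "(\<Sum>p\<in>{1..j}. of_bool (n - i < y p)) = (\<Sum>q\<in>A. of_bool (n - i < q))"
      unfolding y(2)[symmetric]
      by (simp add: sum.reindex inj_on_subset[OF permutes_inj[OF y(1)]])
    also have "\<dots> = k i"
      unfolding k_def card_top_positions_Int[OF A] by simp
    finally show ?thesis .
  qed
  have mono_bool: "mono (\<lambda>x. of_bool (m < x) :: nat)" for m :: nat by (auto simp: mono_def)
  show "is_LPFM_polytope (permutahedron \<inter> {x. a \<bullet> x \<ge> b})"
  proof (rule is_LPFM_polytope_halfspace[where 'n = 'n and X = "{1..j}" and k = k, folded n_def])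
    show "{1..j} \<subseteq> {1..n}" by (rule pre)
    show "is_LPFM n (\<lambda>i. bases_meeting {1..n} {1..j} i (k i))"
    proof (rule is_LPFM_bases_meeting)
      show "meeting_bounds {1..n} {1..j} i (k i)" if "i \<le> n" for i
        using kj ki[OF that] kc[OF that] pre j by (simp add: meeting_bounds_def card_Diff_subset)
      show "is_LPM n (bases_meeting {1..n} {1..j} i (k i))" if "i \<le> n" for i
        using kj ki[OF that] kc[OF that] by (intro is_LPM_bases_meeting_initial j)
    qed (rule kSuc)
    show "permutahedron \<inter> {x. a \<bullet> x \<ge> b}
        = permutahedron \<inter> {x. indicator_point {1..j} \<bullet> x \<ge> real (\<Sum>i\<in>{1..n}. k i)}"
      unfolding ksum a b ..
    show "permutahedron \<inter> {x. a \<bullet> x \<ge> b} = convex hull (perm_point ` {z. bruhat_le n u z \<and> bruhat_le n z top})"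
      unfolding ge Vge ..
    show "z permutes {1..n}" if "z \<in> {z. bruhat_le n u z \<and> bruhat_le n z top}" for z
      using that perm by blast
    show "k i \<le> card (top_positions n z i \<inter> {1..j})"
      if "z \<in> {z. bruhat_le n u z \<and> bruhat_le n z top}" for z i
      using that bruhat_prefix_sum_mono[of n u z "\<lambda>x. of_bool (n - i < x)" j, OF _ mono_bool] k_eq[OF u]
      unfolding card_top_positions_Int[OF pre] by simp
  qed
  have suf: "{Suc j..n} = {1..n} - {1..j}" by auto
  show "is_LPFM_polytope (permutahedron \<inter> {x. a \<bullet> x \<le> b})"
  proof (rule is_LPFM_polytope_halfspace[where 'n = 'n and X = "{Suc j..n}" and k = "\<lambda>i. i - k i", folded n_def])
    show "{Suc j..n} \<subseteq> {1..n}" by auto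
    show "is_LPFM n (\<lambda>i. bases_meeting {1..n} {Suc j..n} i (i - k i))"
    proof (rule is_LPFM_bases_meeting)
      show "meeting_bounds {1..n} {Suc j..n} i (i - k i)" if "i \<le> n" for i
      proof -
        have "{1..n} - {Suc j..n} = {1..j}" using j by auto
        then show ?thesis using kj ki[OF that] kc[OF that] by (simp add: meeting_bounds_def)
      qed
      show "is_LPM n (bases_meeting {1..n} {Suc j..n} i (i - k i))" if "i \<le> n" for i
        using kj[of i] ki[OF that] kc[OF that] by (intro is_LPM_bases_meeting_final j) auto
      show "Suc i - k (Suc i) = i - k i \<or> Suc i - k (Suc i) = Suc (i - k i)" if "i < n" for i
        using kSuc[OF that] ki[of i] that by auto
    qed
    have "(\<Sum>i\<in>{1..n}. i - k i) + \<Sum>A = \<Sum>{1..n}"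
      unfolding ksum[symmetric] sum.distrib[symmetric] using ki by (intro sum.cong) auto
    then have total: "real (\<Sum>i\<in>{1..n}. i - k i) = real (\<Sum>{1..n}) - b"
      unfolding b by (simp only: of_nat_add[symmetric] eq_diff_eq)
    have "indicator_point {Suc j..n} \<bullet> x = real (\<Sum>{1..n}) - a \<bullet> x"
      if "x \<in> permutahedron" for x
      unfolding suf a by (rule inner_complement_permutahedron[OF that pre[unfolded n_def], folded n_def])
    then have "a \<bullet> x \<le> b \<longleftrightarrow> indicator_point {Suc j..n} \<bullet> x \<ge> real (\<Sum>i\<in>{1..n}. i - k i)"
      if "x \<in> permutahedron" for x
      unfolding total using that by simp
    then show "permutahedron \<inter> {x. a \<bullet> x \<le> b}
        = permutahedron \<inter> {x. indicator_point {Suc j..n} \<bullet> x \<ge> real (\<Sum>i\<in>{1..n}. i - k i)}"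
      by blast
    show "permutahedron \<inter> {x. a \<bullet> x \<le> b} = convex hull (perm_point ` {z. bruhat_le n bot z \<and> bruhat_le n z v})"
      unfolding le Vle ..
    show "z permutes {1..n}" if "z \<in> {z. bruhat_le n bot z \<and> bruhat_le n z v}" for z
      using that perm by blast
    show "i - k i \<le> card (top_positions n z i \<inter> {Suc j..n})"
      if z: "z \<in> {z. bruhat_le n bot z \<and> bruhat_le n z v}" and i: "i \<in> {1..n}" for z i
    proof -
      have "card (top_positions n z i \<inter> {1..j}) \<le> k i"
        using z bruhat_prefix_sum_mono[of n z v "\<lambda>x. of_bool (n - i < x)" j, OF _ mono_bool] k_eq[OF v]
        unfolding card_top_positions_Int[OF pre] by simp
      moreover have "top_positions n z i - {1..j} = top_positions n z i \<inter> {Suc j..n}"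
        by (auto simp: top_positions_def)
      moreover have "card (top_positions n z i) = i"
        using card_top_positions[of z n i] perm z i by auto
      ultimately show ?thesis
        using card_Int_Diff[of "top_positions n z i" "{1..j}"] by (simp add: top_positions_def)
    qed
  qed
qed

lemma prefix_vec_eq_indicator_point:
  "(prefix_vec j :: real ^ 'n::{finite,linorder}) = indicator_point {1..j}"
proof -
  have "1 \<le> coord_index i" for i :: 'n
    using coord_index_bij[where 'n = 'n] by (auto simp: bij_betw_def)
  then show ?thesis by (auto simp: prefix_vec_def indicator_point_def vec_eq_iff)
qed

lemma axis_eq_indicator_point: "axis i 1 = indicator_point {coord_index i}"
  using strict_mono_eq[OF coord_index_strict_mono]
  by (auto simp: axis_def indicator_point_def vec_eq_iff)

theorem theorem4p9:
  fixes a :: "real ^ 'n::{finite,linorder}" and b :: real and n :: nat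
  assumes "n = CARD('n)" and "n \<ge> 3"
    and "(\<exists>j. 1 \<le> j \<and> j \<le> n - 2 \<and> a = prefix_vec j \<and>
             b = real (\<Sum>m\<in>{1..<j} \<union> {j + 1}. m))
       \<or> (\<exists>j. 1 \<le> j \<and> j \<le> n - 2 \<and> a = prefix_vec j \<and>
             b = real (\<Sum>m\<in>{n - j} \<union> {n - j + 2..n}. m))
       \<or> (\<exists>i r. coord_index i \<in> {1, n} \<and> 2 \<le> r \<and> r \<le> n - 1 \<and> a = axis i 1 \<and> b = real r)"
  shows "let F\<^sub>1 = permutahedron \<inter> {x. a \<bullet> x \<ge> b};
             F\<^sub>2 = permutahedron \<inter> {x. a \<bullet> x \<le> b}
         in split_along permutahedron a b F\<^sub>1 F\<^sub>2 \<and>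
            is_BIP F\<^sub>1 \<and> is_BIP F\<^sub>2 \<and> is_LPFM_polytope F\<^sub>1 \<and> is_LPFM_polytope F\<^sub>2"
proof -
  note n = assms(1)
  have neq: "S \<noteq> T" if "x \<in> S" "x \<notin> T" for x :: nat and S T using that by blast
  have neq': "S \<noteq> T" if "x \<notin> S" "x \<in> T" for x :: nat and S T using that by blast
  consider (T1) j where "1 \<le> j" "j \<le> n - 2" "a = prefix_vec j" "b = real (\<Sum>({1..<j} \<union> {j + 1}))"
    | (T2) j where "1 \<le> j" "j \<le> n - 2" "a = prefix_vec j" "b = real (\<Sum>({n - j} \<union> {n - j + 2..n}))"
    | (first) i r where "coord_index i = 1" "2 \<le> r" "r \<le> n - 1" "a = axis i 1" "b = real r"
    | (last) i r where "coord_index i = n" "2 \<le> r" "r \<le> n - 1" "a = axis i 1" "b = real r"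
    using assms(3) by blast
  then show ?thesis
  proof cases
    case T1
    let ?A = "{1..<j} \<union> {j + 1}"
    have card: "card ?A = j" using T1(1) by simp
    have "{1..j} = {1..<j} \<union> {j}" using T1(1) by auto
    then have sum: "\<Sum>?A = Suc (\<Sum>{1..j})" by simp
    have uniq: "B = ?A" if "B \<subseteq> {1..n}" "card B = card ?A" "\<Sum>B = \<Sum>?A" for B
    proof -
      have "finite B" using that(1) by (rule finite_subset) simp
      have exch: "{1..j} = insert j (B - {Suc j}) \<and> B = insert (Suc j) ({1..j} - {j})"
      proof (rule sum_exchange_gap(2)[OF \<open>finite B\<close>])
        show "j < x" if "x \<in> B - {1..j}" for x
          using that \<open>B \<subseteq> {1..n}\<close> by (auto simp: not_le)
      qed (use that(2,3) card sum in simp_all)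
      have "?A = insert (Suc j) ({1..j} - {j})" using T1(1) by auto
      with conjunct2[OF exch] show ?thesis by (simp only:)
    qed
    have sub: "?A \<subseteq> {1..n}" using T1(1,2) assms(2) by auto
    have mem: "j + 1 \<in> ?A" "j + 1 \<notin> {1..j}" "n \<notin> ?A" "n \<in> {n - j + 1..n}"
      using T1(1,2) assms(2) by auto
    have "?A \<noteq> {1..card ?A}" unfolding card using mem(1,2) by (rule neq)
    moreover have "?A \<noteq> {n - card ?A + 1..n}" unfolding card using mem(3,4) by (rule neq')
    moreover have "a = indicator_point {1..card ?A}"
      unfolding card T1(3) by (rule prefix_vec_eq_indicator_point)
    ultimately show ?thesis
      unfolding Let_def
      by (intro conjI split_of_unique_prefix_set[of ?A a b, folded n] sub uniq T1(4))
  next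
    case T2
    let ?A = "{n - j} \<union> {n - j + 2..n}" and ?T = "{n - j + 1..n}"
    have card: "card ?A = j" using T2(1,2) assms(2) by simp
    have "?T = insert (n - j + 1) {n - j + 2..n}" using T2(1,2) by auto
    then have sum: "\<Sum>?T = Suc (\<Sum>?A)" by simp
    have uniq: "B = ?A" if "B \<subseteq> {1..n}" "card B = card ?A" "\<Sum>B = \<Sum>?A" for B
    proof -
      have "finite B" using that(1) by (rule finite_subset) simp
      have exch: "B = insert (n - j) (?T - {Suc (n - j)}) \<and> ?T = insert (Suc (n - j)) (B - {n - j})"
      proof (rule sum_exchange_gap(2)[OF _ \<open>finite B\<close>])
        show "x \<le> n - j" if "x \<in> B - ?T" for x
          using that \<open>B \<subseteq> {1..n}\<close> by auto
        show "card ?T = card B" using that(2) card T2(2) by simp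
        show "\<Sum>?T = Suc (\<Sum>B)" using that(3) sum by (simp only:)
      qed auto
      have "?A = insert (n - j) (?T - {Suc (n - j)})" using T2(1,2) by auto
      with conjunct1[OF exch] show ?thesis by (simp only:)
    qed
    have sub: "?A \<subseteq> {1..n}" using T2(1,2) assms(2) by auto
    have mem: "1 \<notin> ?A" "1 \<in> {1..j}" "n - j \<in> ?A" "n - j \<notin> ?T"
      using T2(1,2) assms(2) by auto
    have "?A \<noteq> {1..card ?A}" unfolding card using mem(1,2) by (rule neq')
    moreover have "?A \<noteq> {n - card ?A + 1..n}" unfolding card using mem(3,4) by (rule neq)
    moreover have "a = indicator_point {1..card ?A}"
      unfolding card T2(3) by (rule prefix_vec_eq_indicator_point)
    ultimately show ?thesis
      unfolding Let_def
      by (intro conjI split_of_unique_prefix_set[of ?A a b, folded n] sub uniq T2(4))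
  next
    case first
    have uniq: "B = {r}" if "B \<subseteq> {1..n}" "card B = card {r}" "\<Sum>B = \<Sum>{r}" for B
      using that(2,3) by (auto simp: card_1_singleton_iff)
    have sub: "{r} \<subseteq> {1..n}" using first(2,3) by simp
    have "a = indicator_point {1..card {r}}"
      using first(1,4) by (simp add: axis_eq_indicator_point)
    moreover have "{r} \<noteq> {1..card {r}}" "{r} \<noteq> {n - card {r} + 1..n}"
      using first(2,3) by auto
    moreover have "b = real (\<Sum>{r})" using first(5) by simp
    ultimately show ?thesis
      unfolding Let_def
      by (intro conjI split_of_unique_prefix_set[of "{r}" a b, folded n] sub uniq)
  next
    case last
    let ?A = "{1..n} - {r}"
    \<comment> \<open>The coordinate \<open>x\<^sub>n\<close> is replaced by the prefix of length \<open>n - 1\<close>, whose values on the hyperplane are all but \<open>r\<close>.\<close>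
    let ?p = "indicator_point {1..n - 1} :: (real, 'n) vec"
    have card: "card ?A = n - 1" using last(2,3) by simp
    have total: "\<Sum>?A + r = \<Sum>{1..n}" using last(2,3) sum.remove[of "{1..n}" r "\<lambda>x. x"] by simp
    have uniq: "B = ?A" if B: "B \<subseteq> {1..n}" "card B = card ?A" "\<Sum>B = \<Sum>?A" for B
    proof -
      have fB: "finite B" using B finite_subset by blast
      have "card ({1..n} - B) = 1" using B fB card assms(2) by (simp add: card_Diff_subset)
      then obtain s where s: "{1..n} - B = {s}" by (rule card_1_singletonE)
      have "\<Sum>{1..n} = s + \<Sum>B" using sum.subset_diff[OF B(1), of "\<lambda>x. x"] s by simp
      then have "s = r" using total B(3) by simp
      then show ?thesis using s B(1) by auto
    qed
    have mem: "1 \<in> ?A" "1 \<notin> {n - (n - 1) + 1..n}" "n \<in> ?A" "n \<notin> {1..n - 1}"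
      using last(2,3) assms(2) by auto
    have ne1: "?A \<noteq> {1..card ?A}" unfolding card using mem(3,4) by (rule neq)
    have ne2: "?A \<noteq> {n - card ?A + 1..n}" unfolding card using mem(1,2) by (rule neq)
    have "{1..n} - {1..n - 1} = {n}" using assms(2) by auto
    then have a: "a = indicator_point ({1..n} - {1..n - 1})"
      using last(1,4) by (simp only: axis_eq_indicator_point)
    have opp: "a \<bullet> x - b = real (\<Sum>?A) - ?p \<bullet> x" if x: "x \<in> permutahedron" for x
    proof -
      have "a \<bullet> x = real (\<Sum>{1..n}) - ?p \<bullet> x"
        unfolding a n by (rule inner_complement_permutahedron[OF x]) auto
      then show ?thesis unfolding total[symmetric] last(5) of_nat_add by simp
    qed
    have "a \<noteq> 0" using last(4) by simp
    have "b \<le> a \<bullet> x \<longleftrightarrow> ?p \<bullet> x \<le> real (\<Sum>?A)" "a \<bullet> x \<le> b \<longleftrightarrow> real (\<Sum>?A) \<le> ?p \<bullet> x"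
      if "x \<in> permutahedron" for x
      using opp[OF that] by linarith+
    then have halves: "permutahedron \<inter> {x. a \<bullet> x \<ge> b} = permutahedron \<inter> {x. ?p \<bullet> x \<le> real (\<Sum>?A)}"
      "permutahedron \<inter> {x. a \<bullet> x \<le> b} = permutahedron \<inter> {x. ?p \<bullet> x \<ge> real (\<Sum>?A)}"
      by blast+
    have p: "?p = indicator_point {1..card ?A}" unfolding card ..
    note split = split_of_unique_prefix_set[of ?A ?p "real (\<Sum>?A)", folded n,
        OF Diff_subset uniq ne1 ne2 p refl]
    show ?thesis
      unfolding Let_def halves
      by (intro conjI split_along_opposite[OF split(1) \<open>a \<noteq> 0\<close> opp] split(2-5))
  qed
qed

end
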